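(* Let $(G,\rho)$ be a reduced maximal Gallai multigraph and let $H$ be an induced subgraph of $G$. For every $n\ge 0$, writing $M_n(H)=(\mathcal V_n,\mathcal E_n,\mathcal A_n)$, the following hold: (1) $M_n(H)$ is complete; (2) $|\rho[UW]|=1$ for every $\{U,W\}\in\mathcal E_n$ and $|\rho[UW]|=2$ for every $(U,W)\in\mathcal A_n$; (3) each weak component of $M_n(H)$, together with its directed edges, is a rooted tree; (4) whenever $(U,V),(V,W)\in\mathcal A_n$, we have $\Sigma(U,V)=\Sigma(U,W)$.
   Context: An edge-colored (complete, loopless) multigraph $(G,\rho)$ has a finite vertex set $\mathcal V\subseteq\mathbb N$, ordered by the usual order of $\mathbb N$, and assigns to each unordered pair of distinct vertices $u,v$ a nonempty finite set $\rho[uv]$ of colors (the colors of the parallel edges joining $u$ and $v$; parallel edges have distinct colors). For vertex sets $U,W$ let $\rho[UW]=\bigcup\{\rho[uw]:u\in U,w\in W,u\ne w\}$; a single vertex $u$ is identified with $\{u\}$. Three distinct vertices $u,v,w$ form a rainbow triangle if there are pairwise distinct colors $X\in\rho[uv]$, $Y\in\rho[vw]$, $Z\in\rho[uw]$. $(G,\rho)$ is a Gallai multigraph if it has no rainbow triangle; it is maximal if for every pair $u,v$ and every color $B\notin\rho[uv]$, adding $B$ to $\rho[uv]$ would create a rainbow triangle. A pair $u,v$ is isolated if $\rho[uw]=\rho[vw]$ and $|\rho[uw]|=1$ for every vertex $w\notin\{u,v\}$; $G$ is reduced if no pair is isolated. An induced subgraph on $S\subseteq\mathcal V$ keeps the sets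 $\rho[uv]$ for $u,v\in S$. Dominance: for disjoint nonempty $U,V\subseteq\mathcal V$, $U\triangleright V$ ($U$ dominates $V$) iff $|\rho[UV]|>1$ and either (a) $U=\{u\}$, $V=\{v\}$ and $u<v$, or (b) $|U|>1$ or $|V|>1$, and $\rho[uv]=\rho[uV]$ for all $u\in U$, $v\in V$. The signature $\Sigma(U,V)$ is the map on $U$ given by $u\mapsto\rho[uV]$. Mixed graphs: a mixed graph has undirected edges and directed edges; it is complete if each pair of distinct vertices is joined by exactly one edge, either undirected or directed (in one direction). Its weak components are the connected components of the graph obtained from its directed edges by forgetting directions (undirected edges are ignored). A rooted tree is a transitive directed graph whose transitive reduction is a tree; its root is the unique vertex with a directed edge to every other vertex. For an induced subgraph $H$ of $G$ define $M_n(H)=(\mathcal V_n,\mathcal E_n,\mathcal A_n)$: $\mathcal V_0=V(H)$ (vertices viewed as singletons), $\mathcal A_0=\{(u,v):u\triangleright v\}$, $\mathcal E_0=\{\{u,v\}:|\rho[uv]|=1\}$; for $n\ge1$, $\mathcal V_n$ is the partition of $V(H)$ whose blocks are the unions of the members of $\mathcal V_{n-1}$ lying in a single weak component of $M_{n-1}(H)$, $\mathcal A_n=\{(U,W)\in\mathcal V_n^2:U\triangleright W\}$, and $\mathcal E_n=\{\{U,W\}:U\ne W\in\mathcal V_n,\ |\rho[UW]|=1\}$. *)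

theory Defs
  imports Main "HOL-Library.FuncSet"
begin

section \<open>Edge-colored multigraphs\<close>

text \<open>
  The color set of the edges joining \<open>u\<close> and \<open>v\<close> is \<open>ecolors G {u, v}\<close>, so that symmetry is built in.
  Only the values on two-element subsets of \<open>vertices G\<close> matter.
  The type \<open>'c\<close> is the universe of colors; it may be finite or infinite.
\<close>

record 'c multigraph =
  vertices :: "nat set"
  ecolors :: "nat set \<Rightarrow> 'c set"

definition multigraph :: "'c multigraph \<Rightarrow> bool" where
  "multigraph G \<longleftrightarrow> finite (vertices G) \<and>
     (\<forall>u\<in>vertices G. \<forall>v\<in>vertices G. u \<noteq> v \<longrightarrow>
        finite (ecolors G {u, v}) \<and> ecolors G {u, v} \<noteq> {})"

definition induced :: "'c multigraph \<Rightarrow> nat set \<Rightarrow> 'c multigraph" where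
  "induced G S = G\<lparr>vertices := S\<rparr>"

definition colors_between :: "'c multigraph \<Rightarrow> nat set \<Rightarrow> nat set \<Rightarrow> 'c set" where
  "colors_between G U W = \<Union>{ecolors G {u, w} |u w. u \<in> U \<and> w \<in> W \<and> u \<noteq> w}"

definition rainbow_triangle :: "'c multigraph \<Rightarrow> nat \<Rightarrow> nat \<Rightarrow> nat \<Rightarrow> bool" where
  "rainbow_triangle G u v w \<longleftrightarrow>
     u \<in> vertices G \<and> v \<in> vertices G \<and> w \<in> vertices G \<and> u \<noteq> v \<and> v \<noteq> w \<and> u \<noteq> w \<and>
     (\<exists>X\<in>ecolors G {u, v}. \<exists>Y\<in>ecolors G {v, w}. \<exists>Z\<in>ecolors G {u, w}.
        X \<noteq> Y \<and> Y \<noteq> Z \<and> X \<noteq> Z)"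

definition gallai :: "'c multigraph \<Rightarrow> bool" where
  "gallai G \<longleftrightarrow> multigraph G \<and> \<not> (\<exists>u v w. rainbow_triangle G u v w)"

definition add_color :: "'c multigraph \<Rightarrow> nat \<Rightarrow> nat \<Rightarrow> 'c \<Rightarrow> 'c multigraph" where
  "add_color G u v B =
     G\<lparr>ecolors := (ecolors G)({u, v} := insert B (ecolors G {u, v}))\<rparr>"

definition maximal_gallai :: "'c multigraph \<Rightarrow> bool" where
  "maximal_gallai G \<longleftrightarrow> gallai G \<and>
     (\<forall>u\<in>vertices G. \<forall>v\<in>vertices G. \<forall>B. u \<noteq> v \<and> B \<notin> ecolors G {u, v} \<longrightarrow>
        (\<exists>x y z. rainbow_triangle (add_color G u v B) x y z))"

definition isolated_pair :: "'c multigraph \<Rightarrow> nat \<Rightarrow> nat \<Rightarrow> bool" where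
  "isolated_pair G u v \<longleftrightarrow> u \<in> vertices G \<and> v \<in> vertices G \<and> u \<noteq> v \<and>
     (\<forall>w\<in>vertices G - {u, v}.
        ecolors G {u, w} = ecolors G {v, w} \<and> card (ecolors G {u, w}) = 1)"

definition reduced :: "'c multigraph \<Rightarrow> bool" where
  "reduced G \<longleftrightarrow> \<not> (\<exists>u v. isolated_pair G u v)"

definition dominates :: "'c multigraph \<Rightarrow> nat set \<Rightarrow> nat set \<Rightarrow> bool" where
  "dominates G U V \<longleftrightarrow>
     U \<subseteq> vertices G \<and> V \<subseteq> vertices G \<and> U \<noteq> {} \<and> V \<noteq> {} \<and> U \<inter> V = {} \<and>
     card (colors_between G U V) > 1 \<and>
     ((\<exists>u v. U = {u} \<and> V = {v} \<and> u < v) \<or>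
      (card U > 1 \<or> card V > 1) \<and>
        (\<forall>u\<in>U. \<forall>v\<in>V. ecolors G {u, v} = colors_between G {u} V))"

text \<open>A map on \<open>U\<close>, hence \<open>restrict\<close>: two signatures are equal iff they agree on \<open>U\<close>.\<close>

definition signature :: "'c multigraph \<Rightarrow> nat set \<Rightarrow> nat set \<Rightarrow> nat \<Rightarrow> 'c set" where
  "signature G U V = (\<lambda>u\<in>U. colors_between G {u} V)"


section \<open>Mixed graphs and rooted trees\<close>

record 'a mixed_graph =
  mverts :: "'a set"
  medges :: "'a set set"
  marcs :: "('a \<times> 'a) set"

definition complete_mixed :: "'a mixed_graph \<Rightarrow> bool" where
  "complete_mixed M \<longleftrightarrow> (\<forall>x\<in>mverts M. \<forall>y\<in>mverts M. x \<noteq> y \<longrightarrow>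
     ({x, y} \<in> medges M \<and> (x, y) \<notin> marcs M \<and> (y, x) \<notin> marcs M) \<or>
     ({x, y} \<notin> medges M \<and> (x, y) \<in> marcs M \<and> (y, x) \<notin> marcs M) \<or>
     ({x, y} \<notin> medges M \<and> (x, y) \<notin> marcs M \<and> (y, x) \<in> marcs M))"

definition weak_components :: "'a mixed_graph \<Rightarrow> 'a set set" where
  "weak_components M = mverts M //
     {(x, y) \<in> mverts M \<times> mverts M. (x, y) \<in> (marcs M \<union> (marcs M)\<inverse>)\<^sup>*}"

text \<open>
  Trees are undirected: the arcs in \<open>R\<close> are read without their directions.
  The list of a cycle does not repeat its first vertex at the end.
\<close>

definition undirected_cycle :: "('a \<times> 'a) set \<Rightarrow> 'a list \<Rightarrow> bool" where
  "undirected_cycle R xs \<longleftrightarrow> length xs \<ge> 3 \<and> distinct xs \<and>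
     (\<forall>i<length xs. (xs ! i, xs ! (Suc i mod length xs)) \<in> R \<union> R\<inverse>)"

definition tree :: "'a set \<Rightarrow> ('a \<times> 'a) set \<Rightarrow> bool" where
  "tree V R \<longleftrightarrow> V \<noteq> {} \<and> R \<subseteq> V \<times> V \<and> irrefl R \<and>
     (\<forall>x\<in>V. \<forall>y\<in>V. (x, y) \<in> (R \<union> R\<inverse>)\<^sup>*) \<and>
     \<not> (\<exists>xs. undirected_cycle R xs)"

text \<open>
  For the finite, loopless, transitive digraphs considered here there is exactly one transitive
  reduction, so the existential quantifier in \<open>rooted_tree\<close> refers to the transitive reduction.
\<close>

definition transitive_reduction :: "('a \<times> 'a) set \<Rightarrow> ('a \<times> 'a) set \<Rightarrow> bool" where
  "transitive_reduction A R \<longleftrightarrow> R\<^sup>+ = A\<^sup>+ \<and> (\<forall>R'. R' \<subset> R \<longrightarrow> R'\<^sup>+ \<noteq> A\<^sup>+)"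

definition rooted_tree :: "'a set \<Rightarrow> ('a \<times> 'a) set \<Rightarrow> bool" where
  "rooted_tree V A \<longleftrightarrow> A \<subseteq> V \<times> V \<and> irrefl A \<and> trans A \<and>
     (\<exists>R. transitive_reduction A R \<and> tree V R) \<and>
     (\<exists>!r. r \<in> V \<and> (\<forall>x\<in>V - {r}. (r, x) \<in> A))"


section \<open>The mixed graphs \<open>M\<^sub>n(H)\<close>\<close>

definition mixed_on :: "'c multigraph \<Rightarrow> nat set set \<Rightarrow> nat set mixed_graph" where
  "mixed_on H P =
     \<lparr>mverts = P,
      medges = {{U, W} |U W. U \<in> P \<and> W \<in> P \<and> U \<noteq> W \<and> card (colors_between H U W) = 1},
      marcs = {(U, W) \<in> P \<times> P. dominates H U W}\<rparr>"

primrec mixed :: "'c multigraph \<Rightarrow> nat \<Rightarrow> nat set mixed_graph" where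
  "mixed H 0 = mixed_on H {{v} |v. v \<in> vertices H}"
| "mixed H (Suc n) = mixed_on H (Union ` weak_components (mixed H n))"

end

theory Submission
  imports Defs
begin

text \<open>
  Reducedness bounds every \<open>\<rho>[uv]\<close> by two colors, and two-colored edges sharing a vertex lie in
  two-colored cliques with a common pair of colors; this settles \<open>M\<^sub>0\<close>. From \<open>M\<^sub>1\<close> on all edges
  between different blocks are simple. Each block with more than one vertex carries a pair of colors
  \<open>{A, B}\<close>, inherited from its root and ultimately from a two-colored edge, which is the color set of
  every dominance exercised by the block. Two blocks with different pairs are handled by
  inspecting triangles. If the pairs agree, triangles give nothing, and maximality enters: the edge
  between suitable core vertices of the two blocks misses \<open>A\<close> or \<open>B\<close>, so some vertex \<open>t\<close> of \<open>G\<close>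
  prevents the addition of that color. Such a \<open>t\<close> sees one block in a single color outside \<open>{A, B}\<close>, and
  therefore sees the other block exactly as the first block does.
\<close>

section \<open>Forest orders and weak components\<close>

text \<open>An arc \<open>(x, y)\<close> makes \<open>x\<close> an ancestor of \<open>y\<close>; the
  last conjunct makes the ancestors of each element a chain. Unlike being a rooted tree, this
  concerns a whole mixed graph and passes to each weak component.\<close>

definition forest_order :: "('a \<times> 'a) set \<Rightarrow> bool" where
  "forest_order A \<longleftrightarrow> irrefl A \<and> trans A \<and>
     (\<forall>x y z. (x, z) \<in> A \<and> (y, z) \<in> A \<and> x \<noteq> y \<longrightarrow> (x, y) \<in> A \<or> (y, x) \<in> A)"

text \<open>The tree is the covering relation of \<open>A\<close>. By finiteness it generates
  \<open>A\<close>, and no covering arc is a composition of others. Since ancestors form chains,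
  every element has at most one parent, which excludes cycles.\<close>

lemma rooted_tree_if_forest_order:
  assumes fin: "finite V" and sub: "A \<subseteq> V \<times> V" and order: "forest_order A"
    and r: "r \<in> V" "\<And>x. x \<in> V \<Longrightarrow> x \<noteq> r \<Longrightarrow> (r, x) \<in> A"
  shows "rooted_tree V A"
proof -
  have irr: "irrefl A" and tr: "trans A"
    and forest: "\<And>x y z. (x, z) \<in> A \<Longrightarrow> (y, z) \<in> A \<Longrightarrow> x \<noteq> y \<Longrightarrow> (x, y) \<in> A \<or> (y, x) \<in> A"
    using order unfolding forest_order_def by blast+
  define R where "R = {(x, y) \<in> A. \<not> (\<exists>z. (x, z) \<in> A \<and> (z, y) \<in> A)}"
  have RA: "R \<subseteq> A" by (auto simp: R_def)
  have finA: "finite A" using fin sub finite_subset by blast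
  have Aplus: "A\<^sup>+ = A" using tr by (simp add: trancl_id)
  have acyc: "acyclic A" using irr by (simp add: acyclic_irrefl Aplus)
  have wfA: "wf (A\<inverse>)" using finite_acyclic_wf_converse[OF finA acyc] .
  have "(x, y) \<in> R\<^sup>+" if "(x, y) \<in> A" for x y
    using wfA that
  proof (induction x arbitrary: y)
    case (less x)
    show ?case
    proof (cases "(x, y) \<in> R")
      case False
      define Z where "Z = {z. (x, z) \<in> A \<and> (z, y) \<in> A}"
      have "Z \<noteq> {}" using False less.prems by (auto simp: R_def Z_def)
      moreover have "wf A" using finite_acyclic_wf[OF finA acyc] .
      \<comment> \<open>A \<open>z\<close> between \<open>x\<close> and \<open>y\<close> that is
        nearest to \<open>x\<close> is reached by a covering arc; the induction hypothesis handles
        the rest of the way.\<close>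
      ultimately obtain z where z: "z \<in> Z" "\<And>w. (w, z) \<in> A \<Longrightarrow> w \<notin> Z"
        by (metis all_not_in_conv wfE_min)
      have "(x, z) \<in> R"
        using z tr unfolding Z_def R_def by (auto dest: transD)
      moreover have "(z, y) \<in> R\<^sup>+" using less.IH[of z y] z by (auto simp: Z_def)
      ultimately show ?thesis by (rule trancl_into_trancl2)
    qed auto
  qed
  then have Rplus: "R\<^sup>+ = A" using RA Aplus trancl_mono_subset[OF RA] by auto
  have "transitive_reduction A R"
    unfolding transitive_reduction_def Aplus
  proof (intro conjI allI impI notI)
    fix R' assume R': "R' \<subset> R" "R'\<^sup>+ = A"
    then obtain x y where xy: "(x, y) \<in> R" "(x, y) \<notin> R'" by auto
    then have "(x, y) \<in> R'\<^sup>+" using R' RA by auto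
    \<comment> \<open>A path of length at least two would have its last inner vertex strictly
      between \<open>x\<close> and \<open>y\<close>, which a covering arc forbids.\<close>
    then show False
      by (cases rule: tranclE) (use xy R' RA in \<open>auto simp: R_def\<close>)
  qed (rule Rplus)
  moreover have "tree V R"
    unfolding tree_def
  proof (intro conjI ballI)
    show "irrefl R" using irr RA by (auto simp: irrefl_def)
    have root: "(r, x) \<in> (R \<union> R\<inverse>)\<^sup>*" if "x \<in> V" for x
    proof (cases "x = r")
      case False
      then have "(r, x) \<in> R\<^sup>*" using r(2) that Rplus by (metis trancl_into_rtrancl)
      then show ?thesis by (meson Un_upper1 rtrancl_mono subsetD)
    qed auto
    have "sym ((R \<union> R\<inverse>)\<^sup>*)" by (intro sym_rtrancl sym_Un_converse)
    then show "(x, y) \<in> (R \<union> R\<inverse>)\<^sup>*" if "x \<in> V" "y \<in> V" for x y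
      using root that by (meson rtrancl_trans symD)
    have parent: "x = y" if "(x, z) \<in> R" "(y, z) \<in> R" for x y z
      using that forest[of x z y] by (auto simp: R_def)
    show "\<not> (\<exists>xs. undirected_cycle R xs)"
    proof
      assume "\<exists>xs. undirected_cycle R xs"
      then obtain xs where xs: "length xs \<ge> 3" "distinct xs"
        and adj: "\<And>i. i < length xs \<Longrightarrow> (xs ! i, xs ! (Suc i mod length xs)) \<in> R \<union> R\<inverse>"
        unfolding undirected_cycle_def by blast
      let ?n = "length xs"
      have "set xs \<noteq> {}" using xs by auto
      \<comment> \<open>A vertex of the cycle without descendants on the cycle: both of its
        neighbors must be its parents.\<close>
      then obtain x where x: "x \<in> set xs" "\<And>y. (x, y) \<in> A \<Longrightarrow> y \<notin> set xs"
        using wfE_min[OF wfA] by (metis all_not_in_conv converse_iff)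
      then obtain i where i: "i < ?n" "xs ! i = x" by (metis in_set_conv_nth)
      \<comment> \<open>The indices before and after \<open>i\<close> around the cycle; they differ
        because the length is at least 3.\<close>
      define j where "j = (if i = 0 then ?n - 1 else i - 1)"
      define k where "k = (if Suc i = ?n then 0 else Suc i)"
      have j: "j < ?n" "Suc j mod ?n = i" and k: "k < ?n" "Suc i mod ?n = k"
        using i xs(1) by (auto simp: j_def k_def)
      have "j \<noteq> k" using i xs(1) by (auto simp: j_def k_def)
      have "(xs ! k, x) \<in> R" using adj[of i] i k x(2)[of "xs ! k"] RA by auto
      moreover have "(xs ! j, x) \<in> R" using adj[of j] i j x(2)[of "xs ! j"] RA by auto
      ultimately have "xs ! k = xs ! j" by (rule parent)
      then show False using \<open>j \<noteq> k\<close> j k xs(2) by (simp add: nth_eq_iff_index_eq)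
    qed
  qed (use r RA sub in auto)
  moreover have "\<exists>!r. r \<in> V \<and> (\<forall>x\<in>V - {r}. (r, x) \<in> A)"
    using r tr irr by (metis Diff_iff irreflD singletonD singletonI transD insertI1)
  ultimately show ?thesis
    unfolding rooted_tree_def using sub irr tr by blast
qed

section \<open>Weak components and their roots\<close>

definition weakly_connected :: "'a mixed_graph \<Rightarrow> ('a \<times> 'a) set" where
  "weakly_connected M =
     {(x, y) \<in> mverts M \<times> mverts M. (x, y) \<in> (marcs M \<union> (marcs M)\<inverse>)\<^sup>*}"

lemma weak_components_eq: "weak_components M = mverts M // weakly_connected M"
  by (simp add: weak_components_def weakly_connected_def)

lemma equiv_weakly_connected: "equiv (mverts M) (weakly_connected M)"
proof -
  have "sym ((marcs M \<union> (marcs M)\<inverse>)\<^sup>*)" by (intro sym_rtrancl sym_Un_converse)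
  then show ?thesis
    by (auto simp: weakly_connected_def equiv_def refl_on_def sym_def trans_def)
qed

lemma Union_weak_components: "\<Union> (weak_components M) = mverts M"
  by (simp add: weak_components_eq Union_quotient[OF equiv_weakly_connected])

lemma weak_component_nonempty: "C \<in> weak_components M \<Longrightarrow> C \<noteq> {}"
  using in_quotient_imp_non_empty[OF equiv_weakly_connected] by (simp add: weak_components_eq)

lemma weak_components_disjoint:
  "C \<in> weak_components M \<Longrightarrow> D \<in> weak_components M \<Longrightarrow> C \<noteq> D \<Longrightarrow> C \<inter> D = {}"
  using quotient_disj[OF equiv_weakly_connected] by (metis weak_components_eq)

lemma weak_component_closed:
  assumes "C \<in> weak_components M" "x \<in> C" "y \<in> mverts M" "(x, y) \<in> marcs M \<or> (y, x) \<in> marcs M"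
  shows "y \<in> C"
proof -
  have "x \<in> mverts M" using assms(1,2) Union_weak_components[of M] by auto
  then have "(x, y) \<in> weakly_connected M"
    using assms(3,4) by (auto simp: weakly_connected_def)
  with assms(1,2) show ?thesis
    using in_quotient_imp_closed[OF equiv_weakly_connected] by (metis weak_components_eq)
qed

text \<open>Weakly connected elements have a common ancestor, itself or another: along a path a
  forward arc keeps it, and after a backward arc the new element and the old ancestor lie above the
  same element, so they are comparable and the higher one serves. An element of \<open>C\<close>
  without ancestors in \<open>C\<close> must then be an ancestor of all others.\<close>

lemma weak_component_root:
  assumes fin: "finite (mverts M)" and sub: "marcs M \<subseteq> mverts M \<times> mverts M"
    and order: "forest_order (marcs M)"
    and C: "C \<in> weak_components M"
  obtains r where "r \<in> C" "\<And>x. x \<in> C \<Longrightarrow> x \<noteq> r \<Longrightarrow> (r, x) \<in> marcs M"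
proof -
  let ?A = "marcs M"
  have irr: "irrefl ?A" and tr: "trans ?A"
    and forest: "\<And>x y z. (x, z) \<in> ?A \<Longrightarrow> (y, z) \<in> ?A \<Longrightarrow> x \<noteq> y \<Longrightarrow> (x, y) \<in> ?A \<or> (y, x) \<in> ?A"
    using order unfolding forest_order_def by blast+
  have lower: "\<exists>z. (z, x) \<in> ?A\<^sup>= \<and> (z, y) \<in> ?A\<^sup>=" if "(x, y) \<in> (?A \<union> ?A\<inverse>)\<^sup>*" for x y
    using that
  proof (induction rule: rtrancl_induct)
    case (step y w)
    then obtain z where z: "(z, x) \<in> ?A\<^sup>=" "(z, y) \<in> ?A\<^sup>=" by blast
    show ?case
    proof (cases "(y, w) \<in> ?A")
      case True
      then show ?thesis using z tr by (blast dest: transD)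
    next
      case False
      then have "(w, y) \<in> ?A" using step by auto
      then have "(z, w) \<in> ?A\<^sup>= \<or> (w, z) \<in> ?A\<^sup>=" using z(2) forest[of z y w] by auto
      then show ?thesis using z(1) tr by (blast dest: transD)
    qed
  qed auto
  have finA: "finite ?A" using fin sub finite_subset by blast
  have "acyclic ?A" using irr tr by (simp add: acyclic_irrefl trancl_id)
  then have "wf ?A" using finA by (rule finite_acyclic_wf[rotated])
  then obtain r where r: "r \<in> C" "\<And>y. (y, r) \<in> ?A \<Longrightarrow> y \<notin> C"
    using weak_component_nonempty[OF C] by (metis all_not_in_conv wfE_min)
  have "(r, x) \<in> ?A" if x: "x \<in> C" "x \<noteq> r" for x
  proof -
    have "(r, x) \<in> (?A \<union> ?A\<inverse>)\<^sup>*"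
      using C r(1) x(1) quotient_eq_iff[OF equiv_weakly_connected, of C M C r x]
      by (auto simp: weak_components_eq weakly_connected_def)
    then obtain z where z: "(z, r) \<in> ?A\<^sup>=" "(z, x) \<in> ?A\<^sup>=" using lower by blast
    have "(z, r) \<notin> ?A"
      using r weak_component_closed[OF C r(1), of z] sub by blast
    then show ?thesis using z x by auto
  qed
  then show ?thesis using that r(1) by blast
qed

lemma rooted_tree_weak_component:
  assumes fin: "finite (mverts M)" and sub: "marcs M \<subseteq> mverts M \<times> mverts M"
    and order: "forest_order (marcs M)" and C: "C \<in> weak_components M"
  shows "rooted_tree C (marcs M \<inter> C \<times> C)"
proof -
  obtain r where r: "r \<in> C" "\<And>x. x \<in> C \<Longrightarrow> x \<noteq> r \<Longrightarrow> (r, x) \<in> marcs M"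
    using weak_component_root[OF assms] by blast
  have "C \<subseteq> mverts M" using C Union_weak_components[of M] by auto
  then have "finite C" using fin finite_subset by blast
  moreover have "trans (marcs M \<inter> C \<times> C)"
    using order unfolding forest_order_def trans_def by blast
  then have "forest_order (marcs M \<inter> C \<times> C)"
    using order unfolding forest_order_def irrefl_def by blast
  ultimately show ?thesis using rooted_tree_if_forest_order[of C "marcs M \<inter> C \<times> C" r] r by auto
qed


section \<open>Reduced maximal Gallai multigraphs\<close>

locale reduced_maximal_gallai =
  fixes G :: "'c multigraph" and S :: "nat set"
  assumes maximal: "maximal_gallai G" and reduced: "reduced G" and S_subset: "S \<subseteq> vertices G"
begin

definition rho :: "nat \<Rightarrow> nat \<Rightarrow> 'c set" where
  "rho u v = ecolors G {u, v}"

text \<open>Junk unless \<open>rho u v\<close> is a singleton.\<close>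

definition col :: "nat \<Rightarrow> nat \<Rightarrow> 'c" where
  "col u v = the_elem (rho u v)"

lemma rho_commute: "rho u v = rho v u"
  by (simp add: rho_def insert_commute)

lemma finite_vertices: "finite (vertices G)"
  using maximal by (simp add: maximal_gallai_def gallai_def multigraph_def)

lemma finite_S: "finite S"
  using S_subset finite_vertices by (rule finite_subset)

lemma rho_finite: "u \<in> vertices G \<Longrightarrow> v \<in> vertices G \<Longrightarrow> u \<noteq> v \<Longrightarrow> finite (rho u v)"
  and rho_nonempty: "u \<in> vertices G \<Longrightarrow> v \<in> vertices G \<Longrightarrow> u \<noteq> v \<Longrightarrow> rho u v \<noteq> {}"
  using maximal by (auto simp: maximal_gallai_def gallai_def multigraph_def rho_def)

lemma no_rainbow:
  assumes "u \<in> vertices G" "v \<in> vertices G" "w \<in> vertices G" "u \<noteq> v" "v \<noteq> w" "u \<noteq> w"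
    and "X \<in> rho u v" "Y \<in> rho v w" "Z \<in> rho u w"
  shows "X = Y \<or> Y = Z \<or> X = Z"
proof -
  have "\<not> rainbow_triangle G u v w"
    using maximal by (simp add: maximal_gallai_def gallai_def)
  then show ?thesis using assms unfolding rainbow_triangle_def rho_def by blast
qed

section \<open>Consequences of reducedness and maximality for small color configurations\<close>

text \<open>If \<open>uv\<close> had three colors, two different colors on \<open>uw\<close> and
  \<open>vw\<close> would leave a third one on \<open>uv\<close> and give a rainbow triangle. Hence
  every \<open>w\<close> would see \<open>u\<close> and \<open>v\<close> in one and the same color,
  and the pair would be isolated.\<close>

lemma card_rho_le_2:
  assumes uv: "u \<in> vertices G" "v \<in> vertices G" "u \<noteq> v"
  shows "card (rho u v) \<le> 2"
proof (rule ccontr)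
  assume "\<not> card (rho u v) \<le> 2"
  then have big: "card (rho u v) \<ge> 3" by simp
  have eq: "X = Y" if w: "w \<in> vertices G - {u, v}" and "X \<in> rho u w" "Y \<in> rho v w" for w X Y
  proof (rule ccontr)
    assume "X \<noteq> Y"
    have "\<not> rho u v \<subseteq> {X, Y}"
    proof
      assume "rho u v \<subseteq> {X, Y}"
      then have "card (rho u v) \<le> card {X, Y}" by (rule card_mono[rotated]) simp
      also have "\<dots> \<le> 2" by (simp add: card_insert_if)
      finally show False using big by simp
    qed
    then obtain Z where "Z \<in> rho u v" "Z \<noteq> X" "Z \<noteq> Y" by auto
    then show False using no_rainbow[of u v w Z Y X] that uv \<open>X \<noteq> Y\<close> by auto
  qed
  have "rho u w = rho v w \<and> card (rho u w) = 1" if w: "w \<in> vertices G - {u, v}" for w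
  proof -
    obtain X Y where XY: "X \<in> rho u w" "Y \<in> rho v w"
      using rho_nonempty[of u w] rho_nonempty[of v w] w uv by auto
    then have "rho u w = {X}" "rho v w = {X}" using eq[OF w] by blast+
    then show ?thesis by simp
  qed
  then have "isolated_pair G u v" using uv unfolding isolated_pair_def rho_def by blast
  then show False using reduced by (auto simp: reduced_def)
qed

text \<open>A triangle created by \<open>B\<close> must use \<open>B\<close> on \<open>uv\<close>,
  since \<open>G\<close> has no rainbow triangle. Let \<open>t\<close> be its third vertex. Its
  other two colors differ from each other and from \<open>B\<close>; replacing \<open>B\<close> by
  \<open>A\<close> gives a triangle of \<open>G\<close>, so one of them is \<open>A\<close>. The
  other one is \<open>X\<close>.\<close>

lemma maximality:
  assumes uv: "u \<in> vertices G" "v \<in> vertices G" "u \<noteq> v" and AB: "A \<in> rho u v" "B \<notin> rho u v"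
  obtains (witness) t X where "t \<in> vertices G" "t \<noteq> u" "t \<noteq> v" "X \<noteq> A" "X \<noteq> B"
    "A \<in> rho t u \<and> X \<in> rho t v \<or> X \<in> rho t u \<and> A \<in> rho t v"
proof -
  let ?G = "add_color G u v B"
  obtain x y z where rb: "rainbow_triangle ?G x y z"
    using maximal uv AB unfolding maximal_gallai_def rho_def by blast
  have [simp]: "vertices ?G = vertices G" by (simp add: add_color_def)
  have ec: "ecolors ?G {a, b} = (if {a, b} = {u, v} then insert B (rho u v) else rho a b)" for a b
    by (simp add: add_color_def rho_def)
  obtain X Y Z where xyz: "x \<in> vertices G" "y \<in> vertices G" "z \<in> vertices G" "x \<noteq> y" "y \<noteq> z" "x \<noteq> z"
    and X: "X \<in> ecolors ?G {x, y}" and Y: "Y \<in> ecolors ?G {y, z}" and Z: "Z \<in> ecolors ?G {x, z}"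
    and XYZ: "X \<noteq> Y" "Y \<noteq> Z" "X \<noteq> Z"
    using rb unfolding rainbow_triangle_def by auto
  have third: thesis
    if t: "t \<in> vertices G" "t \<noteq> u" "t \<noteq> v" "P \<in> rho t u" "Q \<in> rho t v"
      and "P \<noteq> Q" "P \<noteq> B" "Q \<noteq> B" for t P Q
  proof -
    have "P = A \<or> Q = A"
      using no_rainbow[of u v t A Q P] that uv AB by (auto simp: rho_commute)
    then show thesis using t that(6-8) witness[of t P] witness[of t Q] by auto
  qed
  \<comment> \<open>The cases only locate \<open>uv\<close> in the triangle; in the last one the
    triangle avoids \<open>uv\<close> and is already rainbow in \<open>G\<close>.\<close>
  consider "{x, y} = {u, v}" | "{y, z} = {u, v}" | "{x, z} = {u, v}"
    | "{x, y} \<noteq> {u, v}" "{y, z} \<noteq> {u, v}" "{x, z} \<noteq> {u, v}" by blast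
  then show thesis
  proof cases
    case 1
    then have "{y, z} \<noteq> {u, v}" "{x, z} \<noteq> {u, v}" "z \<noteq> u" "z \<noteq> v" "x = u \<and> y = v \<or> x = v \<and> y = u"
      using xyz by (auto simp: doubleton_eq_iff)
    moreover from this have "X = B"
      using no_rainbow[OF xyz] X Y Z XYZ 1 by (metis ec insertE rho_def)
    ultimately show thesis
      using third[of z Y Z] third[of z Z Y] xyz XYZ Y Z
      by (auto simp: ec rho_commute)
  next
    case 2
    then have "{x, y} \<noteq> {u, v}" "{x, z} \<noteq> {u, v}" "x \<noteq> u" "x \<noteq> v" "y = u \<and> z = v \<or> y = v \<and> z = u"
      using xyz by (auto simp: doubleton_eq_iff)
    moreover from this have "Y = B"
      using no_rainbow[OF xyz] X Y Z XYZ 2 by (metis ec insertE rho_def)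
    ultimately show thesis
      using third[of x X Z] third[of x Z X] xyz XYZ X Z
      by (auto simp: ec rho_commute)
  next
    case 3
    then have "{x, y} \<noteq> {u, v}" "{y, z} \<noteq> {u, v}" "y \<noteq> u" "y \<noteq> v" "x = u \<and> z = v \<or> x = v \<and> z = u"
      using xyz by (auto simp: doubleton_eq_iff)
    moreover from this have "Z = B"
      using no_rainbow[OF xyz] X Y Z XYZ 3 by (metis ec insertE rho_def)
    ultimately show thesis
      using third[of y X Y] third[of y Y X] xyz XYZ X Y
      by (auto simp: ec rho_commute)
  next
    case 4
    then show thesis using no_rainbow[OF xyz] X Y Z XYZ by (simp add: ec) blast
  qed
qed

text \<open>Sharing a two-colored edge is thus transitive, with constant colors. The triangle alone
  gives the color set of \<open>vw\<close> and the inclusion for \<open>uw\<close>; that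
  \<open>uw\<close> has both colors needs maximality.\<close>

lemma bicoloured_triangle:
  assumes uvw: "u \<in> vertices G" "v \<in> vertices G" "w \<in> vertices G" "u \<noteq> v" "v \<noteq> w" "u \<noteq> w"
    and two: "card (rho u v) = 2" "card (rho v w) = 2"
  shows "rho v w = rho u v" and "rho u w = rho u v"
proof -
  obtain A B where AB: "rho u v = {A, B}" "A \<noteq> B" using two(1) by (auto simp: card_2_iff)
  obtain Z where Z: "Z \<in> rho u w" using rho_nonempty uvw by blast
  have tri: "P = Q \<or> Q = R \<or> P = R" if "P \<in> {A, B}" "Q \<in> rho v w" "R \<in> rho u w" for P Q R
    using no_rainbow[OF uvw] that AB by blast
  have sub: "rho v w \<subseteq> {A, B}"
  proof
    \<comment> \<open>A color \<open>C\<close> outside \<open>{A, B}\<close> forces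
      \<open>uw\<close> to have \<open>C\<close> only; the second color of \<open>vw\<close> then
      makes a rainbow triangle with \<open>C\<close> and \<open>A\<close> or
      \<open>B\<close>.\<close>
    fix C assume C: "C \<in> rho v w"
    show "C \<in> {A, B}"
    proof (rule ccontr)
      assume out: "C \<notin> {A, B}"
      have "rho u w \<subseteq> {C}" using tri[OF _ C] AB(2) out by blast
      then have "Z = C" using Z by auto
      obtain D where "D \<in> rho v w" "D \<noteq> C" using two(2) C by (auto simp: card_2_iff)
      then show False using tri[OF _ _ Z] \<open>Z = C\<close> AB(2) out by blast
    qed
  qed
  moreover have "card {A, B} = 2" using AB by simp
  ultimately show vw: "rho v w = rho u v"
    using AB two by (metis card_subset_eq finite.emptyI finite_insert)
  have in_AB: "rho u w \<subseteq> {A, B}" using tri vw AB by blast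
  have full: "Q \<in> rho u w" if PQ: "{P, Q} = {A, B}" "P \<in> rho u w" for P Q
  proof (rule ccontr)
    assume "Q \<notin> rho u w"
    then obtain t X where t: "t \<in> vertices G" "t \<noteq> u" "t \<noteq> w" "X \<noteq> P" "X \<noteq> Q"
      and c: "P \<in> rho t u \<and> X \<in> rho t w \<or> X \<in> rho t u \<and> P \<in> rho t w"
      using maximality[of u w P Q] uvw PQ by blast
    have "P \<noteq> Q" "rho u v = {P, Q}" "rho w v = {P, Q}" "rho v u = {P, Q}"
      using AB PQ vw by (auto simp: rho_commute)
    \<comment> \<open>\<open>v\<close> sees \<open>u\<close> and \<open>w\<close> in
      \<open>P\<close> and \<open>Q\<close> only, while \<open>t\<close> sees one of them in
      \<open>X\<close>.\<close>
    have "t \<noteq> v" using c t vw AB PQ(1) by (auto simp: rho_commute)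
    then obtain Y where Y: "Y \<in> rho t v" using rho_nonempty t uvw by blast
    have u: "R = R' \<or> R' = Y \<or> R = Y" if "R \<in> rho t u" "R' \<in> {P, Q}" for R R'
      using no_rainbow[of t u v R R' Y] that Y t \<open>t \<noteq> v\<close> uvw \<open>rho u v = {P, Q}\<close> by blast
    have w: "R = R' \<or> R' = Y \<or> R = Y" if "R \<in> rho t w" "R' \<in> {P, Q}" for R R'
      using no_rainbow[of t w v R R' Y] that Y t \<open>t \<noteq> v\<close> uvw \<open>rho w v = {P, Q}\<close> by blast
    \<comment> \<open>The end that \<open>t\<close> sees in \<open>X\<close> forces
      \<open>Y = X\<close>; at the other end \<open>P\<close>, \<open>Q\<close> and \<open>X\<close>
      are then rainbow.\<close>
    show False using u w c t \<open>P \<noteq> Q\<close> by (metis insertCI)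
  qed
  have "Z = A \<or> Z = B" using in_AB Z by auto
  then have "A \<in> rho u w \<and> B \<in> rho u w" using full[of A B] full[of B A] Z by auto
  then show "rho u w = rho u v" using in_AB AB by auto
qed

end


section \<open>Palettes and dominance\<close>

text \<open>Read \<open>f\<close> as a matrix and suppose that a row \<open>x\<close> and a column
  \<open>y1\<close> both vary. Row \<open>x\<close> takes both values \<open>E\<close> and
  \<open>F\<close>, so it has an entry outside \<open>{A, B}\<close>, whose column \<open>z\<close>
  is constant. Column \<open>y1\<close> stays in \<open>{A, B}\<close>, so every row differs at
  \<open>y1\<close> and \<open>z\<close> and lies in \<open>{E, F}\<close>. The value of column
  \<open>z\<close> and two values of column \<open>y1\<close> are too many for
  \<open>{E, F}\<close>.\<close>

lemma rows_or_columns_constant: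
  fixes f :: "'a \<Rightarrow> 'b \<Rightarrow> 'c"
  assumes col: "\<And>y. y \<in> Y \<Longrightarrow> (\<exists>c. \<forall>x\<in>X. f x y = c) \<or> (\<forall>x\<in>X. f x y \<in> {A, B})"
    and row: "\<And>x. x \<in> X \<Longrightarrow> (\<exists>c. \<forall>y\<in>Y. f x y = c) \<or> (\<forall>y\<in>Y. f x y \<in> {E, F})"
    and neq: "{A, B} \<noteq> {E, F}"
  shows "(\<forall>x\<in>X. \<forall>y\<in>Y. \<forall>y'\<in>Y. f x y = f x y') \<or> (\<forall>y\<in>Y. \<forall>x\<in>X. \<forall>x'\<in>X. f x y = f x' y)"
proof (rule ccontr)
  assume "\<not> ?thesis"
  then obtain x y y' x1 x2 y1 where xy: "x \<in> X" "y \<in> Y" "y' \<in> Y" "f x y \<noteq> f x y'"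
    and xy1: "x1 \<in> X" "x2 \<in> X" "y1 \<in> Y" "f x1 y1 \<noteq> f x2 y1" by blast
  have r: "\<forall>y\<in>Y. f x y \<in> {E, F}" using row[OF xy(1)] xy by metis
  have c: "\<forall>x\<in>X. f x y1 \<in> {A, B}" using col[OF xy1(3)] xy1 by metis
  have "{f x y, f x y'} = {E, F}" using bspec[OF r xy(2)] bspec[OF r xy(3)] xy(4) by auto
  moreover have "{f x1 y1, f x2 y1} = {A, B}"
    using bspec[OF c xy1(1)] bspec[OF c xy1(2)] xy1(4) by auto
  ultimately have "\<exists>z\<in>Y. f x z \<notin> {A, B}"
    using neq xy xy1 by (metis insert_commute insert_iff singletonD)
  then obtain z where z: "z \<in> Y" "f x z \<notin> {A, B}" by blast
  then have cz: "\<forall>x'\<in>X. f x' z = f x z" using col[OF z(1)] xy(1) by metis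
  have "f x' y1 \<in> {E, F}" if "x' \<in> X" for x'
  proof -
    have "f x' y1 \<noteq> f x' z" using c cz z that by metis
    then show ?thesis using row[OF that] z xy1 by metis
  qed
  moreover have "f x z \<in> {E, F}" using r z by auto
  moreover have "f x z \<noteq> f x1 y1" "f x z \<noteq> f x2 y1" using z c xy1 by auto
  ultimately show False using xy1 by (metis insertE singletonD)
qed

context reduced_maximal_gallai
begin

section \<open>Separated sets, dominance between them, and palettes\<close>

definition separated :: "nat set \<Rightarrow> nat set \<Rightarrow> bool" where
  "separated U W \<longleftrightarrow> U \<subseteq> S \<and> W \<subseteq> S \<and> U \<noteq> {} \<and> W \<noteq> {} \<and> U \<inter> W = {} \<and>
     (\<forall>u\<in>U. \<forall>w\<in>W. card (rho u w) = 1)"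

definition monochromatic :: "nat set \<Rightarrow> nat set \<Rightarrow> bool" where
  "monochromatic U W \<longleftrightarrow> (\<exists>c. \<forall>u\<in>U. \<forall>w\<in>W. col u w = c)"

text \<open>The form of \<open>dominates\<close> on separated sets
  (\<open>dominates_iff_dom\<close>): rows of the color matrix are constant, but not the whole
  matrix. The vertex order no longer enters.\<close>

definition sep_dominates :: "nat set \<Rightarrow> nat set \<Rightarrow> bool" where
  "sep_dominates U W \<longleftrightarrow> separated U W \<and> (\<forall>u\<in>U. \<forall>w\<in>W. \<forall>w'\<in>W. col u w = col u w') \<and>
     \<not> monochromatic U W"

text \<open>
  Every vertex of \<open>S - U\<close> sees \<open>r\<close> and \<open>s\<close> alike, so the last alternative can only occur for \<open>t\<close>
  outside \<open>S\<close>: such a \<open>t\<close> may see a part of \<open>U\<close> in a third color although another part meets it in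
  both \<open>A\<close> and \<open>B\<close>.
\<close>

definition core :: "'c \<Rightarrow> 'c \<Rightarrow> nat set \<Rightarrow> nat \<Rightarrow> bool" where
  "core A B U k \<longleftrightarrow> k \<in> U \<and> (\<forall>u\<in>U - {k}. rho k u \<subseteq> {A, B}) \<and>
     (\<forall>t\<in>vertices G - U.
        (\<exists>X. X \<notin> {A, B} \<and> (\<forall>u\<in>U. rho t u = {X})) \<or>
        rho t k \<subseteq> {A, B} \<and>
          ((\<forall>u\<in>U. rho t u \<subseteq> {A, B}) \<or>
           (\<exists>r\<in>U. \<exists>s\<in>U. rho t r = {A} \<and> rho t s = {B} \<and> (\<forall>y\<in>S - U. rho y r = rho y s))))"

text \<open>\<open>A\<close> and \<open>B\<close> will be the two colors of every dominance
  exercised by \<open>U\<close> (\<open>sep_dominates_palette\<close>). The core vertex is the place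
  where maximality is applied.\<close>

definition palette :: "'c \<Rightarrow> 'c \<Rightarrow> nat set \<Rightarrow> bool" where
  "palette A B U \<longleftrightarrow> A \<noteq> B \<and> U \<subseteq> S \<and> (\<exists>k. core A B U k)"

lemma core_cases:
  assumes "core A B U k" "t \<in> vertices G - U"
  obtains (outside) X where "X \<notin> {A, B}" "\<And>u. u \<in> U \<Longrightarrow> rho t u = {X}"
  | (inside) "rho t k \<subseteq> {A, B}" "\<And>u. u \<in> U \<Longrightarrow> rho t u \<subseteq> {A, B}"
  | (split) r s where "rho t k \<subseteq> {A, B}" "r \<in> U" "s \<in> U" "rho t r = {A}" "rho t s = {B}"
      "\<And>y. y \<in> S - U \<Longrightarrow> rho y r = rho y s"
  using bspec[OF conjunct2[OF conjunct2[OF assms(1)[unfolded core_def]]] assms(2)]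
proof (elim disjE exE conjE bexE)
  show thesis if "X \<notin> {A, B}" "\<forall>u\<in>U. rho t u = {X}" for X
    using outside[OF that(1)] that(2) by simp
  show thesis if "rho t k \<subseteq> {A, B}" "\<forall>u\<in>U. rho t u \<subseteq> {A, B}"
    using inside[OF that(1)] that(2) by simp
  show thesis if "rho t k \<subseteq> {A, B}" "r \<in> U" "s \<in> U" "rho t r = {A}" "rho t s = {B}"
    "\<forall>y\<in>S - U. rho y r = rho y s" for r s
    using split[OF that(1-5)] that(6) by simp
qed

lemma core_swap:
  assumes "core A B U k"
  shows "core B A U k"
  unfolding core_def
proof (intro conjI ballI)
  show "k \<in> U" using assms by (simp add: core_def)
  show "rho k u \<subseteq> {B, A}" if "u \<in> U - {k}" for u
    using assms that by (auto simp: core_def)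
  show "(\<exists>X. X \<notin> {B, A} \<and> (\<forall>u\<in>U. rho t u = {X})) \<or>
      rho t k \<subseteq> {B, A} \<and>
        ((\<forall>u\<in>U. rho t u \<subseteq> {B, A}) \<or>
         (\<exists>r\<in>U. \<exists>s\<in>U. rho t r = {B} \<and> rho t s = {A} \<and> (\<forall>y\<in>S - U. rho y r = rho y s)))"
    if "t \<in> vertices G - U" for t
    using assms that
  proof (cases rule: core_cases)
    case (split r s)
    then have "\<forall>y\<in>S - U. rho y s = rho y r" by simp
    then show ?thesis using split(1-5) by blast
  qed blast+
qed

lemma palette_swap: "palette A B U \<Longrightarrow> palette B A U"
  by (auto simp: palette_def intro: core_swap)

lemma col_commute: "col u w = col w u"
  by (simp add: col_def rho_commute)

lemma separated_commute: "separated U W \<Longrightarrow> separated W U"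
  unfolding separated_def by (subst rho_commute) blast

lemma monochromatic_commute: "monochromatic U W \<Longrightarrow> monochromatic W U"
  unfolding monochromatic_def by (subst col_commute) blast

lemma rho_eq_col:
  assumes "separated U W" "u \<in> U" "w \<in> W"
  shows "rho u w = {col u w}" and "rho w u = {col u w}"
proof -
  show "rho u w = {col u w}"
    using assms unfolding separated_def col_def by (metis card_1_singletonE the_elem_eq)
  then show "rho w u = {col u w}" by (simp add: rho_commute)
qed

lemma separated_vertices:
  assumes "separated U W" "u \<in> U" "w \<in> W"
  shows "u \<in> vertices G" "w \<in> vertices G" "u \<noteq> w" "u \<in> S" "w \<in> S" "u \<notin> W" "w \<notin> U"
  using assms S_subset unfolding separated_def by auto

text \<open>The third alternative of \<open>core\<close> would make \<open>y\<close> see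
  \<open>r\<close> in \<open>A\<close> and \<open>s\<close> in \<open>B\<close>, although vertices
  of \<open>S - U\<close> see them alike.\<close>

lemma palette_from_S:
  assumes "palette A B U" "y \<in> S - U"
  shows "(\<exists>X. X \<notin> {A, B} \<and> (\<forall>u\<in>U. rho y u = {X})) \<or> (\<forall>u\<in>U. rho y u \<subseteq> {A, B})"
proof -
  obtain k where k: "core A B U k" and "A \<noteq> B" using assms by (auto simp: palette_def)
  have "y \<in> vertices G - U" using assms S_subset by auto
  with k show ?thesis
  proof (cases rule: core_cases)
    case (split r s)
    then show ?thesis using split(6)[of y] assms(2) \<open>A \<noteq> B\<close> by simp
  qed blast+
qed

lemma palette_column:
  assumes "palette A B U" "separated U W" "w \<in> W"
  shows "(\<exists>c. \<forall>u\<in>U. col u w = c) \<or> (\<forall>u\<in>U. col u w \<in> {A, B})"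
proof -
  have "w \<in> S - U" using assms by (auto simp: separated_def)
  then show ?thesis
    using palette_from_S[OF assms(1)] rho_eq_col(2)[OF assms(2) _ assms(3)]
    by (metis insert_subset singleton_inject)
qed

text \<open>With constant rows, failing to be monochromatic means that a single column already
  varies. By \<open>palette_column\<close> it then stays in \<open>{A, B}\<close>, and both colors
  occur.\<close>

lemma sep_dominates_palette:
  assumes d: "sep_dominates U W" and p: "palette A B U"
  shows "\<And>u w. u \<in> U \<Longrightarrow> w \<in> W \<Longrightarrow> col u w \<in> {A, B}"
    and "\<exists>u\<in>U. \<forall>w\<in>W. col u w = A" and "\<exists>u\<in>U. \<forall>w\<in>W. col u w = B"
proof -
  have sep: "separated U W" and rows: "\<And>u w w'. u \<in> U \<Longrightarrow> w \<in> W \<Longrightarrow> w' \<in> W \<Longrightarrow> col u w = col u w'"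
    and nm: "\<not> monochromatic U W" using d unfolding sep_dominates_def by blast+
  obtain w0 where w0: "w0 \<in> W" using sep by (auto simp: separated_def)
  have not_const: "\<nexists>c. \<forall>u\<in>U. col u w0 = c" using nm rows w0 unfolding monochromatic_def by metis
  then have two: "\<forall>u\<in>U. col u w0 \<in> {A, B}" using palette_column[OF p sep w0] by blast
  then show "\<And>u w. u \<in> U \<Longrightarrow> w \<in> W \<Longrightarrow> col u w \<in> {A, B}" using rows w0 by metis
  have "\<exists>u\<in>U. col u w0 = A" "\<exists>u\<in>U. col u w0 = B"
    using not_const two by blast+
  then show "\<exists>u\<in>U. \<forall>w\<in>W. col u w = A" "\<exists>u\<in>U. \<forall>w\<in>W. col u w = B"
    using rows w0 by metis+
qed

section \<open>Vertices supplied by maximality for two sets with the same palette\<close>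

text \<open>Seeing \<open>l\<close> in \<open>X\<close> puts \<open>t\<close> into the first
  alternative of the core of \<open>W\<close>. The triangles \<open>t\<close>, \<open>u\<close>,
  \<open>w\<close> leave only \<open>col u w\<close> and \<open>X\<close> for
  \<open>rho t u\<close>, and the core of \<open>U\<close> removes \<open>X\<close>. So
  \<open>t\<close> sees \<open>U\<close> exactly as each vertex of \<open>W\<close> does.\<close>

lemma core_witness:
  assumes AB: "A \<noteq> B" and k: "core A B U k" and l: "core A B W l" and sep: "separated U W"
    and cols: "\<And>u w. u \<in> U \<Longrightarrow> w \<in> W \<Longrightarrow> col u w \<in> {A, B}"
    and t: "t \<in> vertices G" "t \<notin> U" "t \<notin> W"
    and P: "P \<in> rho t k" "P \<in> {A, B}" and X: "X \<in> rho t l" "X \<notin> {A, B}"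
  shows "\<forall>w\<in>W. rho t w = {X}" and "\<forall>u\<in>U. \<forall>w\<in>W. rho t u = {col u w}"
proof -
  have lW: "l \<in> W" using l by (simp add: core_def)
  have kU: "k \<in> U" using k by (simp add: core_def)
  have tW': "t \<in> vertices G - W" and tU': "t \<in> vertices G - U" using t by auto
  from l tW' show tW: "\<forall>w\<in>W. rho t w = {X}"
    by (cases rule: core_cases) (use X lW in auto)
  have tri: "Q = col u w \<or> Q = X" if "u \<in> U" "w \<in> W" "Q \<in> rho t u" for u w Q
    using no_rainbow[of t u w Q "col u w" X] that tW rho_eq_col[OF sep that(1,2)]
      separated_vertices[OF sep that(1,2)] t cols[OF that(1,2)] X by fastforce
  from k tU' have "\<forall>u\<in>U. rho t u \<subseteq> {A, B}"
  proof (cases rule: core_cases)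
    case (outside Y)
    then show ?thesis using P kU by auto
  next
    \<comment> \<open>The triangles make \<open>l\<close> see \<open>r\<close> in \<open>A\<close>
      and \<open>s\<close> in \<open>B\<close>, but as a vertex of \<open>S - U\<close> it sees them
      alike.\<close>
    case (split r s)
    have "col r l = A" "col s l = B" using tri[of r l A] tri[of s l B] split lW X by auto
    moreover have "l \<in> S - U" using sep lW by (auto simp: separated_def)
    ultimately show ?thesis
      using split AB rho_eq_col(2)[OF sep split(2) lW] rho_eq_col(2)[OF sep split(3) lW] by auto
  qed blast
  then have "rho t u \<subseteq> {col u w}" if "u \<in> U" "w \<in> W" for u w
    using tri[OF that] X that by auto
  moreover have "rho t u \<noteq> {}" if "u \<in> U" for u
    using rho_nonempty[of t u] t that separated_vertices[OF sep that lW] by auto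
  ultimately show "\<forall>u\<in>U. \<forall>w\<in>W. rho t u = {col u w}" by (meson subset_singletonD)
qed

text \<open>The edge between the core vertices has one color, so one of \<open>A\<close> and
  \<open>B\<close> is missing there and maximality provides \<open>t\<close>. In case
  \<open>left\<close> the color \<open>col u w\<close> does not depend on \<open>w\<close>, in case
  \<open>right\<close> not on \<open>u\<close>.\<close>

lemma palette_witness:
  assumes pU: "palette A B U" and pW: "palette A B W" and sep: "separated U W"
    and "\<forall>u\<in>U. \<forall>w\<in>W. col u w \<in> {A, B}"
  obtains (left) t X where "t \<in> vertices G" "t \<notin> U" "t \<notin> W" "X \<notin> {A, B}"
      "\<And>w. w \<in> W \<Longrightarrow> rho t w = {X}" "\<And>u w. u \<in> U \<Longrightarrow> w \<in> W \<Longrightarrow> rho t u = {col u w}"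
  | (right) t X where "t \<in> vertices G" "t \<notin> U" "t \<notin> W" "X \<notin> {A, B}"
      "\<And>u. u \<in> U \<Longrightarrow> rho t u = {X}" "\<And>u w. u \<in> U \<Longrightarrow> w \<in> W \<Longrightarrow> rho t w = {col u w}"
proof -
  have cols: "\<And>u w. u \<in> U \<Longrightarrow> w \<in> W \<Longrightarrow> col u w \<in> {A, B}" using assms(4) by blast
  obtain k l where k: "core A B U k" and l: "core A B W l" and AB: "A \<noteq> B"
    using pU pW by (auto simp: palette_def)
  have kU: "k \<in> U" "\<forall>u\<in>U - {k}. rho k u \<subseteq> {A, B}" and lW: "l \<in> W" "\<forall>u\<in>W - {l}. rho l u \<subseteq> {A, B}"
    using k l by (simp_all add: core_def)
  define P where "P = col k l"
  have P: "P \<in> {A, B}" "rho k l = {P}" using cols kU lW rho_eq_col[OF sep] by (auto simp: P_def)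
  obtain Q where Q: "{P, Q} = {A, B}" "P \<noteq> Q" using P AB by auto
  obtain t X where t: "t \<in> vertices G" "t \<noteq> k" "t \<noteq> l" "X \<noteq> P" "X \<noteq> Q"
    and tX: "P \<in> rho t k \<and> X \<in> rho t l \<or> X \<in> rho t k \<and> P \<in> rho t l"
    using maximality[of k l P Q] P Q separated_vertices[OF sep kU(1) lW(1)] by auto
  have X: "X \<notin> {A, B}" using t Q by auto
  \<comment> \<open>Inside either set, \<open>t\<close> would see both core vertices in colors of
    \<open>{A, B}\<close> only, which excludes \<open>X\<close>.\<close>
  have "t \<notin> U"
  proof
    assume "t \<in> U"
    then have "rho t k \<subseteq> {A, B}" "rho t l \<subseteq> {A, B}"
      using kU(2) t cols[of t l] rho_eq_col(1)[OF sep, of t l] lW(1) rho_commute[of k t]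
      by (metis Diff_iff empty_subsetI insert_subset singletonD)+
    then show False using tX X by auto
  qed
  moreover have "t \<notin> W"
  proof
    assume "t \<in> W"
    then have "rho t l \<subseteq> {A, B}" "rho t k \<subseteq> {A, B}"
      using lW(2) t cols[of k t] rho_eq_col(2)[OF sep, of k t] kU(1) rho_commute[of l t]
      by (metis Diff_iff empty_subsetI insert_subset singletonD)+
    then show False using tX X by auto
  qed
  moreover have "\<And>u w. u \<in> W \<Longrightarrow> w \<in> U \<Longrightarrow> col u w \<in> {A, B}"
    using cols col_commute by metis
  ultimately have "t \<notin> U" "t \<notin> W" "\<And>u w. u \<in> W \<Longrightarrow> w \<in> U \<Longrightarrow> col u w \<in> {A, B}" by auto
  note outside = this
  from tX show thesis
  proof
    assume "P \<in> rho t k \<and> X \<in> rho t l"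
    then show thesis
      using left[of t X] t(1) outside X P(1) core_witness[OF AB k l sep cols, of t P X] by blast
  next
    assume "X \<in> rho t k \<and> P \<in> rho t l"
    then have *: "\<forall>u\<in>U. rho t u = {X}" "\<forall>w\<in>W. \<forall>u\<in>U. rho t w = {col w u}"
      using t(1) outside X P(1)
        core_witness[OF AB l k separated_commute[OF sep] outside(3), of t P X] by blast+
    have "rho t w = {col u w}" if "u \<in> U" "w \<in> W" for u w
      using *(2) that by (simp add: col_commute[of u w])
    then show thesis
      using right[of t X] t(1) outside X *(1) by blast
  qed
qed

section \<open>How two blocks are related, and how dominances compose\<close>

definition block :: "nat set \<Rightarrow> bool" where
  "block U \<longleftrightarrow> card U = 1 \<or> (\<exists>A B. palette A B U)"

text \<open>For palettes with different color pairs \<open>rows_or_columns_constant\<close> decides.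
  For equal pairs with all cross colors in \<open>{A, B}\<close>, the vertex from
  \<open>palette_witness\<close> makes rows or columns constant.\<close>

lemma separated_complete:
  assumes sep: "separated U W" and bU: "block U" and bW: "block W"
  shows "monochromatic U W \<or> sep_dominates U W \<or> sep_dominates W U"
proof -
  have rows: ?thesis if "\<forall>u\<in>U. \<forall>w\<in>W. \<forall>w'\<in>W. col u w = col u w'"
    using that sep unfolding sep_dominates_def by blast
  have columns: ?thesis if "\<forall>w\<in>W. \<forall>u\<in>U. \<forall>u'\<in>U. col u w = col u' w"
  proof -
    have "\<forall>w\<in>W. \<forall>u\<in>U. \<forall>u'\<in>U. col w u = col w u'" using that by (subst (1 2) col_commute)
    then show ?thesis
      using separated_commute[OF sep] monochromatic_commute unfolding sep_dominates_def by blast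
  qed
  consider "card U = 1" | "card W = 1" | A B E F where "palette A B U" "palette E F W"
    using bU bW by (auto simp: block_def)
  then show ?thesis
  proof cases
    case 1
    then show ?thesis by (intro columns) (auto simp: card_1_singleton_iff)
  next
    case 2
    then show ?thesis by (intro rows) (auto simp: card_1_singleton_iff)
  next
    case (3 A B E F)
    have col: "(\<exists>c. \<forall>u\<in>U. col u w = c) \<or> (\<forall>u\<in>U. col u w \<in> {A, B})" if "w \<in> W" for w
      using palette_column[OF 3(1) sep that] .
    have row: "(\<exists>c. \<forall>w\<in>W. col u w = c) \<or> (\<forall>w\<in>W. col u w \<in> {E, F})" if "u \<in> U" for u
      using palette_column[OF 3(2) separated_commute[OF sep] that] unfolding col_commute[of _ u] .
    show ?thesis
    proof (cases "{A, B} = {E, F}")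
      case False
      then show ?thesis
        using rows_or_columns_constant[of W U col A B E F, OF col row] rows columns by blast
    next
      case True
      then have pW: "palette A B W" using 3(2) palette_swap by (auto simp: doubleton_eq_iff)
      show ?thesis
      proof (cases "\<forall>u\<in>U. \<forall>w\<in>W. col u w \<in> {A, B}")
        case True
        with 3(1) pW sep show ?thesis
        proof (cases rule: palette_witness)
          case (left t X)
          then show ?thesis by (intro rows ballI) (metis singleton_inject)
        next
          case (right t X)
          then show ?thesis by (intro columns ballI) (metis singleton_inject)
        qed
      next
        case False
        \<comment> \<open>A color outside \<open>{A, B}\<close> fills its column, since a varying
          column stays in \<open>{A, B}\<close>; for the same reason it then fills every
          row.\<close>
        then obtain x y where xy: "x \<in> U" "y \<in> W" "col x y \<notin> {A, B}" by blast
        then have c: "col u y = col x y" if "u \<in> U" for u using col[of y] that by metis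
        have "col u w = col x y" if "u \<in> U" "w \<in> W" for u w
          using row[OF that(1)] c[OF that(1)] xy that \<open>{A, B} = {E, F}\<close> by metis
        then show ?thesis by (auto simp: monochromatic_def)
      qed
    qed
  qed
qed

text \<open>\<open>w\<close> sees \<open>U\<close> in both \<open>A\<close> and \<open>B\<close>, so
  a color of \<open>tw\<close> lies in \<open>{X, A}\<close> as well as in \<open>{X, B}\<close>. A
  foreign color thus passes from a dominating set to the dominated one.\<close>

lemma sep_dominates_outside:
  assumes d: "sep_dominates U W" and p: "palette A B U" and t: "t \<in> vertices G" "t \<notin> U"
    and X: "X \<notin> {A, B}" "\<And>u. u \<in> U \<Longrightarrow> rho t u = {X}" and w: "w \<in> W"
  shows "t \<noteq> w" and "rho t w = {X}"
proof -
  have sep: "separated U W" and AB: "A \<noteq> B" using d p by (auto simp: sep_dominates_def palette_def)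
  obtain u v where u: "u \<in> U" "col u w = A" and v: "v \<in> U" "col v w = B"
    using sep_dominates_palette(2,3)[OF d p] w by blast
  show "t \<noteq> w"
    using rho_eq_col(2)[OF sep u(1) w] X u by auto
  then have ne: "rho t w \<noteq> {}"
    using rho_nonempty t separated_vertices[OF sep u(1) w] by blast
  have tri: "Y = X \<or> Y = col x w" if "x \<in> U" "Y \<in> rho t w" "col x w \<in> {A, B}" for x Y
    using no_rainbow[of t x w X "col x w" Y] that rho_eq_col(1)[OF sep that(1) w] X t \<open>t \<noteq> w\<close>
      separated_vertices[OF sep that(1) w] by fastforce
  have "Y = X" if "Y \<in> rho t w" for Y
    using tri[OF u(1) that] tri[OF v(1) that] u v AB by auto
  then show "rho t w = {X}" using ne by blast
qed

text \<open>This equation yields both transitivity of dominance and equality of signatures.\<close>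

lemma sep_dominates_trans:
  assumes d: "sep_dominates U V" and d': "sep_dominates V W" and sep: "separated U W"
    and p: "palette A B U" and p': "palette E F V"
    and u: "u \<in> U" and v: "v \<in> V" and w: "w \<in> W"
  shows "col u w = col u v"
proof -
  have sUV: "separated U V" and sVW: "separated V W" and AB: "A \<noteq> B" and EF: "E \<noteq> F"
    using d d' p p' by (auto simp: sep_dominates_def palette_def)
  have rows: "col u v = col u v'" if "u \<in> U" "v \<in> V" "v' \<in> V" for u v v'
    using d that unfolding sep_dominates_def by blast
  have tri: "col u v = col v w \<or> col v w = col u w \<or> col u v = col u w"
    if "u \<in> U" "v \<in> V" "w \<in> W" for u v w
    using no_rainbow[of u v w "col u v" "col v w" "col u w"] rho_eq_col(1)[OF sUV that(1,2)]
      rho_eq_col(1)[OF sVW that(2,3)] rho_eq_col(1)[OF sep that(1,3)]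
      separated_vertices[OF sUV that(1,2)] separated_vertices[OF sVW that(2,3)]
      separated_vertices[OF sep that(1,3)] by auto
  obtain v1 v2 where v1: "v1 \<in> V" "col v1 w = E" and v2: "v2 \<in> V" "col v2 w = F"
    using sep_dominates_palette(2,3)[OF d' p'] w by blast
  \<comment> \<open>\<open>w\<close> sees \<open>V\<close> in both \<open>E\<close> and
    \<open>F\<close>, while \<open>u\<close> sees \<open>V\<close> in one color; compare the two
    triangles.\<close>
  have alt: "col u w = col u v \<or> {col u w, col u v} = {E, F}" if "u \<in> U" for u
    using tri[OF that v1(1) w] tri[OF that v2(1) w] rows[OF that v1(1) v] rows[OF that v2(1) v] v1 v2 EF
    by auto
  have s: "col u v \<in> {A, B}" if "u \<in> U" for u using sep_dominates_palette(1)[OF d p that v] .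
  show ?thesis
  proof (cases "{A, B} = {E, F}")
    case False
    show ?thesis
    proof (rule ccontr)
      assume neq: "col u w \<noteq> col u v"
      then have EF': "{col u w, col u v} = {E, F}" using alt[OF u] by blast
      \<comment> \<open>\<open>w\<close> then sees all of \<open>U\<close> in this foreign color, so
        \<open>alt\<close> would pair it with each of the two different colors in which
        \<open>v\<close> sees \<open>U\<close>.\<close>
      then have out: "col u w \<notin> {A, B}" using False neq s[OF u] by auto
      then have const: "col u' w = col u w" if "u' \<in> U" for u'
        using palette_column[OF p sep w] u that by metis
      obtain u' where u': "u' \<in> U" "col u' v \<noteq> col u v"
        using sep_dominates_palette(2,3)[OF d p] v AB by metis
      then have "col u' w \<noteq> col u' v" using const out s by metis
      then have "{col u w, col u' v} = {E, F}" using alt[OF u'(1)] const[OF u'(1)] by auto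
      then show False using EF' neq u' by (auto simp: doubleton_eq_iff)
    qed
  next
    case True
    then have pV: "palette A B V" using p' palette_swap by (auto simp: doubleton_eq_iff)
    have cols: "\<forall>u\<in>U. \<forall>v\<in>V. col u v \<in> {A, B}" using sep_dominates_palette(1)[OF d p] by blast
    from p pV sUV cols show ?thesis
    proof (cases rule: palette_witness)
      case (left t X)
      \<comment> \<open>\<open>t\<close> sees \<open>V\<close> in \<open>X\<close> and hence also
        \<open>w\<close>, while it sees \<open>u\<close> in \<open>col u v\<close>; the triangle
        \<open>t\<close>, \<open>u\<close>, \<open>w\<close> decides.\<close>
      have tw: "t \<noteq> w" "rho t w = {X}" using sep_dominates_outside[OF d' pV left(1,3,4,5) w] by auto
      have *: "X \<noteq> col u v" "X \<noteq> col u w" using left(4) s[OF u] alt[OF u] True by auto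
      have "t \<noteq> u" using left(2) u by blast
      with * show ?thesis
        using no_rainbow[of t u w "col u v" "col u w" X] tw left(6)[OF u v] left(1,2) u
          rho_eq_col(1)[OF sep u w] separated_vertices[OF sep u w] by auto
    next
      case (right t X)
      \<comment> \<open>Here \<open>col u v\<close> would not depend on \<open>u\<close>, contrary
        to the dominance of \<open>U\<close> over \<open>V\<close>.\<close>
      then show ?thesis using sep_dominates_palette(2,3)[OF d p] v AB by (metis singleton_inject)
    qed
  qed
qed

text \<open>With \<open>separated_complete\<close> this makes two sets dominating the same set
  comparable. A common color \<open>Z\<close> is refuted by triangles if the color pairs differ. If
  they agree, triangles only give \<open>Z\<close> in \<open>{A, B}\<close>, and
  \<open>palette_witness\<close> is needed.\<close>

lemma sep_dominates_forest:
  assumes d: "sep_dominates U W" and d': "sep_dominates V W" and sep: "separated U V"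
    and p: "palette A B U" and p': "palette E F V"
  shows "\<not> monochromatic U V"
proof
  assume "monochromatic U V"
  then obtain Z where Z: "\<And>u v. u \<in> U \<Longrightarrow> v \<in> V \<Longrightarrow> col u v = Z" unfolding monochromatic_def by blast
  have sUW: "separated U W" and sVW: "separated V W" and AB: "A \<noteq> B" and EF: "E \<noteq> F"
    using d d' p p' by (auto simp: sep_dominates_def palette_def)
  obtain w where w: "w \<in> W" using sUW by (auto simp: separated_def)
  have tri: "P = Q \<or> Z = P \<or> Z = Q" if "P \<in> {A, B}" "Q \<in> {E, F}" for P Q
  proof -
    have "\<exists>u\<in>U. col u w = P" "\<exists>v\<in>V. col v w = Q"
      using sep_dominates_palette(2,3)[OF d p] sep_dominates_palette(2,3)[OF d' p'] w that by fast+
    then obtain u v where u: "u \<in> U" "col u w = P" and v: "v \<in> V" "col v w = Q" by blast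
    show ?thesis
      using no_rainbow[of u v w Z Q P] rho_eq_col(1)[OF sUW u(1) w] rho_eq_col(1)[OF sVW v(1) w]
        rho_eq_col(1)[OF sep u(1) v(1)] Z u v separated_vertices[OF sep u(1) v(1)]
        separated_vertices[OF sUW u(1) w] separated_vertices[OF sVW v(1) w] by auto
  qed
  show False
  proof (cases "{A, B} = {E, F}")
    case False
    then show False using tri[of A E] tri[of A F] tri[of B E] tri[of B F] AB EF by auto
  next
    case True
    then have pV: "palette A B V" using p' palette_swap by (auto simp: doubleton_eq_iff)
    have ZAB: "Z \<in> {A, B}" using tri[of A B] AB True by auto
    \<comment> \<open>\<open>t\<close> sees \<open>V\<close>, and therefore \<open>w\<close>, in
      \<open>X\<close>, and sees \<open>U\<close> in \<open>Z\<close>. A vertex \<open>u\<close>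
      that sees \<open>w\<close> in the other color of \<open>{A, B}\<close> completes a rainbow
      triangle.\<close>
    have half: False
      if d: "sep_dominates U W" "palette A B U" and d': "sep_dominates V W" "palette A B V"
        and t: "t \<in> vertices G" "t \<notin> U" "t \<notin> V" "X \<notin> {A, B}" "\<And>v. v \<in> V \<Longrightarrow> rho t v = {X}"
        and tu: "\<And>u. u \<in> U \<Longrightarrow> rho t u = {Z}" for U V t X
    proof -
      have tw: "t \<noteq> w" "rho t w = {X}" using sep_dominates_outside[OF d' t(1,3,4,5) w] by auto
      obtain a b where "a \<in> U" "b \<in> U" "col a w = A" "col b w = B"
        using sep_dominates_palette(2,3)[OF d] w by blast
      then obtain u where u: "u \<in> U" "col u w \<noteq> Z" "col u w \<in> {A, B}"
        using AB that[of a] that[of b] by (cases "Z = A") auto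
      have sep: "separated U W" using d by (simp add: sep_dominates_def)
      have "t \<noteq> u" using t(2) u(1) by blast
      show False
        using no_rainbow[of t u w Z "col u w" X] tw tu[OF u(1)] u ZAB t(1,2,4) \<open>t \<noteq> u\<close>
          rho_eq_col(1)[OF sep u(1) w] separated_vertices[OF sep u(1) w] by auto
    qed
    have cols: "\<forall>u\<in>U. \<forall>v\<in>V. col u v \<in> {A, B}" using Z ZAB by simp
    obtain u v where uv: "u \<in> U" "v \<in> V" using sep by (auto simp: separated_def)
    from p pV sep cols show False
    proof (cases rule: palette_witness)
      case (left t X)
      then show False using half[OF d p d' pV, of t X] Z uv by auto
    next
      case (right t X)
      then show False using half[OF d' pV d p, of t X] Z uv by auto
    qed
  qed
qed

section \<open>Palettes of weak components\<close>

text \<open>The union keeps the palette and the core vertex of its root \<open>R\<close>. Foreign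
  colors pass down by \<open>sep_dominates_outside\<close>. The third alternative of
  \<open>core\<close> exists for the vertices \<open>t\<close> that see \<open>R\<close> inside
  \<open>{A, B}\<close> but some dominated vertex in a foreign color.\<close>

lemma palette_Union:
  assumes p: "palette A B R" and C: "\<And>V. V \<in> C \<Longrightarrow> sep_dominates R V"
    and out: "\<And>y r s. y \<in> S - (R \<union> \<Union>C) \<Longrightarrow> r \<in> R \<Longrightarrow> s \<in> R \<Longrightarrow> rho y r = rho y s"
  shows "palette A B (R \<union> \<Union>C)"
proof -
  obtain k where k: "core A B R k" and AB: "A \<noteq> B" and RS: "R \<subseteq> S"
    using p by (auto simp: palette_def)
  have kR: "k \<in> R" using k by (simp add: core_def)
  have "core A B (R \<union> \<Union>C) k"
    unfolding core_def
  proof (intro conjI ballI)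
    show "k \<in> R \<union> \<Union>C" using kR by simp
    show "rho k u \<subseteq> {A, B}" if u: "u \<in> R \<union> \<Union>C - {k}" for u
    proof (cases "u \<in> R")
      case True
      then show ?thesis using k u by (auto simp: core_def)
    next
      case False
      then obtain V where V: "V \<in> C" "u \<in> V" using u by auto
      then have "separated R V" using C by (auto simp: sep_dominates_def)
      then show ?thesis using rho_eq_col(1)[OF _ kR V(2)] sep_dominates_palette(1)[OF C p kR] V by auto
    qed
    fix t assume t: "t \<in> vertices G - (R \<union> \<Union>C)"
    let ?goal = "(\<exists>X. X \<notin> {A, B} \<and> (\<forall>u\<in>R \<union> \<Union>C. rho t u = {X})) \<or>
      rho t k \<subseteq> {A, B} \<and>
        ((\<forall>u\<in>R \<union> \<Union>C. rho t u \<subseteq> {A, B}) \<or>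
         (\<exists>r\<in>R \<union> \<Union>C. \<exists>s\<in>R \<union> \<Union>C. rho t r = {A} \<and> rho t s = {B} \<and>
           (\<forall>y\<in>S - (R \<union> \<Union>C). rho y r = rho y s)))"
    from t have tR: "t \<in> vertices G - R" by auto
    from k tR show ?goal
    proof (cases rule: core_cases)
      case (outside X)
      have "rho t u = {X}" if "u \<in> R \<union> \<Union>C" for u
        using that outside(2) sep_dominates_outside(2)[OF C p _ _ outside] tR by auto
      then show ?thesis using outside(1) by blast
    next
      case (split r s)
      then show ?thesis using split(6) by (metis DiffD1 DiffD2 DiffI UnCI)
    next
      case inside
      show ?thesis
      proof (cases "\<forall>u\<in>\<Union>C. rho t u \<subseteq> {A, B}")
        case True
        then show ?thesis using inside by blast
      next
        case False
        \<comment> \<open>The triangles \<open>t\<close>, \<open>r\<close>, \<open>v\<close> force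
          \<open>t\<close> to see \<open>R\<close> exactly as \<open>v\<close> does, hence one
          vertex in \<open>A\<close> only and another in \<open>B\<close> only; \<open>out\<close>
          supplies the rest of the third alternative.\<close>
        then obtain V v X where v: "V \<in> C" "v \<in> V" "X \<in> rho t v" "X \<notin> {A, B}" by blast
        have sep: "separated R V" using C[OF v(1)] by (simp add: sep_dominates_def)
        have "t \<noteq> v" using t v by auto
        have tr: "rho t r = {col r v}" if r: "r \<in> R" for r
        proof -
          have "Y = col r v" if "Y \<in> rho t r" for Y
            using no_rainbow[of t r v Y "col r v" X] that r v t tR \<open>t \<noteq> v\<close> inside(2)[OF r]
              rho_eq_col(1)[OF sep r v(2)] sep_dominates_palette(1)[OF C[OF v(1)] p r v(2)]
              separated_vertices[OF sep r v(2)] by fastforce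
          moreover have "rho t r \<noteq> {}"
            using rho_nonempty[of t r] tR r separated_vertices[OF sep r v(2)] by auto
          ultimately show ?thesis by blast
        qed
        obtain r s where "r \<in> R" "s \<in> R" "col r v = A" "col s v = B"
          using sep_dominates_palette(2,3)[OF C[OF v(1)] p] v(2) by blast
        then show ?thesis using inside(1) out tr by (metis UnI1)
      qed
    qed
  qed
  moreover have "\<Union>C \<subseteq> S" using C by (fastforce simp: sep_dominates_def separated_def)
  ultimately show ?thesis using AB RS unfolding palette_def by blast
qed

text \<open>The base case: by \<open>bicoloured_triangle\<close> all edges of the set have the
  colors \<open>A\<close> and \<open>B\<close>. A foreign color from \<open>t\<close> to one vertex
  then spreads to all, so only the first two alternatives of \<open>core\<close> arise.\<close>

lemma palette_bicoloured_clique: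
  assumes "insert r C \<subseteq> S" "r \<notin> C" "C \<noteq> {}" and AB: "A \<noteq> B" and rC: "\<And>v. v \<in> C \<Longrightarrow> rho r v = {A, B}"
  shows "palette A B (insert r C)"
proof -
  let ?U = "insert r C"
  have UG: "?U \<subseteq> vertices G" using assms S_subset by auto
  have clique: "rho x y = {A, B}" if "x \<in> ?U" "y \<in> ?U" "x \<noteq> y" for x y
  proof (cases "x = r \<or> y = r")
    case True
    then show ?thesis using that rC[of x] rC[of y] rho_commute[of x r] by auto
  next
    case False
    then show ?thesis
      using that bicoloured_triangle(2)[of x r y] rC AB UG assms(2) rho_commute[of x r] by auto
  qed
  have "core A B ?U r"
    unfolding core_def
  proof (intro conjI ballI)
    show "rho r u \<subseteq> {A, B}" if "u \<in> ?U - {r}" for u using rC that by auto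
    fix t assume t: "t \<in> vertices G - ?U"
    have spread: "rho t y = {X}"
      if x: "x \<in> ?U" "X \<in> rho t x" "X \<notin> {A, B}" and y: "y \<in> ?U" "x \<noteq> y" for x y X
    proof -
      have "Y = X" if "Y \<in> rho t y" for Y
        using no_rainbow[of t x y X A Y] no_rainbow[of t x y X B Y] t UG clique[OF x(1) y] x y that AB
        by auto
      then show ?thesis using rho_nonempty[of t y] t UG y by blast
    qed
    \<comment> \<open>Going to another vertex \<open>z\<close> and back shows that \<open>t\<close>
      sees \<open>x\<close> itself in \<open>X\<close> only.\<close>
    have spread': "rho t y = {X}"
      if x: "x \<in> ?U" "X \<in> rho t x" "X \<notin> {A, B}" and y: "y \<in> ?U" for x y X
    proof (cases "x = y")
      case True
      obtain z where z: "z \<in> ?U" "z \<noteq> y" using assms(2,3) by (cases "y = r") auto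
      then have "X \<in> rho t z" using spread[OF x] True by auto
      then show ?thesis using spread[OF z(1) _ x(3) y z(2)] by blast
    qed (use spread[OF x y] in blast)
    show "(\<exists>X. X \<notin> {A, B} \<and> (\<forall>u\<in>?U. rho t u = {X})) \<or> rho t r \<subseteq> {A, B} \<and>
      ((\<forall>u\<in>?U. rho t u \<subseteq> {A, B}) \<or> (\<exists>r\<in>?U. \<exists>s\<in>?U. rho t r = {A} \<and> rho t s = {B} \<and>
         (\<forall>y\<in>S - ?U. rho y r = rho y s)))"
    proof (cases "\<forall>u\<in>?U. rho t u \<subseteq> {A, B}")
      case True
      then show ?thesis by blast
    next
      case False
      then obtain x X where "x \<in> ?U" "X \<in> rho t x" "X \<notin> {A, B}" by blast
      then show ?thesis using spread' by blast
    qed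
  qed simp
  then show ?thesis using assms(1) AB unfolding palette_def by blast
qed

end


section \<open>The levels of the decomposition\<close>

context reduced_maximal_gallai
begin

section \<open>Dominance and color counts in the induced subgraph\<close>

abbreviation H :: "'c multigraph" where "H \<equiv> induced G S"

lemma vertices_H [simp]: "vertices H = S"
  by (simp add: induced_def)

lemma ecolors_H: "ecolors H {u, v} = rho u v"
  by (simp add: induced_def rho_def)

lemma mixed_on_simps [simp]:
  "mverts (mixed_on H P) = P"
  "medges (mixed_on H P) =
     {{U, W} |U W. U \<in> P \<and> W \<in> P \<and> U \<noteq> W \<and> card (colors_between H U W) = 1}"
  "marcs (mixed_on H P) = {(U, W) \<in> P \<times> P. dominates H U W}"
  by (simp_all add: mixed_on_def)

lemma colors_between_commute: "colors_between H U W = colors_between H W U"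
  unfolding colors_between_def by (subst insert_commute) blast

lemma medges_iff:
  "{U, W} \<in> medges (mixed_on H P) \<longleftrightarrow>
     U \<in> P \<and> W \<in> P \<and> U \<noteq> W \<and> card (colors_between H U W) = 1"
  using colors_between_commute[of U W] unfolding mixed_on_simps(2) by (auto simp: doubleton_eq_iff)

lemma colors_between_singletons: "u \<noteq> v \<Longrightarrow> colors_between H {u} {v} = rho u v"
  by (auto simp: colors_between_def ecolors_H)

lemma colors_between_separated:
  assumes "separated U W"
  shows "colors_between H U W = (\<Union>u\<in>U. col u ` W)"
    and "u \<in> U \<Longrightarrow> colors_between H {u} W = col u ` W"
proof -
  have "colors_between H T W = (\<Union>u\<in>T. col u ` W)" if "T \<subseteq> U" for T
  proof -
    have "ecolors H {u, w} = {col u w} \<and> u \<noteq> w" if "u \<in> T" "w \<in> W" for u w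
      using rho_eq_col(1)[OF assms, of u w] separated_vertices(3)[OF assms, of u w] that \<open>T \<subseteq> U\<close>
      by (auto simp: ecolors_H)
    then show ?thesis unfolding colors_between_def by fastforce
  qed
  from this[of U] this[of "{u}"] show "colors_between H U W = (\<Union>u\<in>U. col u ` W)"
    "u \<in> U \<Longrightarrow> colors_between H {u} W = col u ` W" by auto
qed

lemma separated_finite:
  assumes "separated U W"
  shows "finite U" "finite W" "U \<noteq> {}" "W \<noteq> {}" "U \<subseteq> S" "W \<subseteq> S" "U \<inter> W = {}"
  using assms finite_S unfolding separated_def by (auto intro: finite_subset)

lemma card_colors_between_eq_1:
  assumes "separated U W"
  shows "card (colors_between H U W) = 1 \<longleftrightarrow> monochromatic U W"
proof
  assume "card (colors_between H U W) = 1"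
  then obtain c where "colors_between H U W = {c}" by (auto simp: card_1_singleton_iff)
  then show "monochromatic U W"
    unfolding monochromatic_def colors_between_separated(1)[OF assms] by blast
next
  assume "monochromatic U W"
  then obtain c where "\<forall>u\<in>U. \<forall>w\<in>W. col u w = c" unfolding monochromatic_def by blast
  then have "colors_between H U W = {c}"
    using separated_finite(3,4)[OF assms] unfolding colors_between_separated(1)[OF assms] by auto
  then show "card (colors_between H U W) = 1" by simp
qed

text \<open>Two separated singletons are joined by one color only, so clause (a) of
  \<open>dominates\<close> never applies and clause (b) says that rows are constant.\<close>

lemma dominates_iff_dom:
  assumes sep: "separated U W"
  shows "dominates H U W \<longleftrightarrow> sep_dominates U W"
proof
  assume d: "dominates H U W"
  then have "\<not> monochromatic U W"
    using card_colors_between_eq_1[OF sep] by (auto simp: dominates_def)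
  moreover have "col u w = col u w'" if "u \<in> U" "w \<in> W" "w' \<in> W" for u w w'
  proof -
    have "(\<exists>u w. U = {u} \<and> W = {w}) \<or> (\<forall>u\<in>U. \<forall>w\<in>W. rho u w = col u ` W)"
      using d colors_between_separated(2)[OF sep] unfolding dominates_def ecolors_H by auto
    then show ?thesis using rho_eq_col(1)[OF sep] that by fastforce
  qed
  ultimately show "sep_dominates U W" using sep unfolding sep_dominates_def by blast
next
  assume d: "sep_dominates U W"
  have "card (colors_between H U W) \<noteq> 1" using d card_colors_between_eq_1[OF sep] by (auto simp: sep_dominates_def)
  moreover have "card (colors_between H U W) > 0"
    using separated_finite[OF sep] unfolding colors_between_separated(1)[OF sep] card_gt_0_iff by auto
  ultimately have c: "card (colors_between H U W) > 1" by linarith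
  have "card U > 0" "card W > 0" using separated_finite[OF sep] by (auto simp: card_gt_0_iff)
  moreover have "\<not> (card U = 1 \<and> card W = 1)"
    using d by (auto simp: sep_dominates_def monochromatic_def card_1_singleton_iff)
  ultimately have "card U > 1 \<or> card W > 1" by linarith
  moreover have "ecolors H {u, w} = colors_between H {u} W" if "u \<in> U" "w \<in> W" for u w
  proof -
    have "col u ` W = {col u w}" using d that unfolding sep_dominates_def by blast
    then show ?thesis
      using rho_eq_col(1)[OF sep that] colors_between_separated(2)[OF sep that(1)]
      by (simp add: ecolors_H)
  qed
  ultimately show "dominates H U W"
    unfolding dominates_def using c separated_finite[OF sep] by simp
qed

text \<open>A singleton cannot dominate here: its one constant row would be monochromatic.\<close>

lemma sep_dominates_imp_palette:
  assumes "sep_dominates U W" "block U"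
  obtains A B where "palette A B U"
proof -
  have "card U \<noteq> 1"
  proof
    assume "card U = 1"
    then obtain u where U: "U = {u}" by (auto simp: card_1_singleton_iff)
    obtain w where w: "w \<in> W" using assms(1) unfolding sep_dominates_def separated_def by blast
    then have "\<forall>w'\<in>W. col u w' = col u w" using assms(1) U unfolding sep_dominates_def by blast
    then show False using assms(1) U unfolding sep_dominates_def monochromatic_def by blast
  qed
  then show thesis using assms(2) that by (auto simp: block_def)
qed

lemma card_colors_between_dom:
  assumes d: "sep_dominates U W" and b: "block U"
  shows "card (colors_between H U W) = 2"
proof -
  obtain A B where p: "palette A B U" using sep_dominates_imp_palette[OF assms] .
  have sep: "separated U W" using d by (simp add: sep_dominates_def)
  then obtain w where w: "w \<in> W" using separated_finite(4) by blast
  have "colors_between H U W \<subseteq> {A, B}"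
    using sep_dominates_palette(1)[OF d p] unfolding colors_between_separated(1)[OF sep] by blast
  moreover obtain a b where "a \<in> U" "b \<in> U" "col a w = A" "col b w = B"
    using sep_dominates_palette(2,3)[OF d p] w by blast
  then have "A \<in> colors_between H U W" "B \<in> colors_between H U W"
    using w unfolding colors_between_separated(1)[OF sep] by (metis UN_I imageI)+
  ultimately have "colors_between H U W = {A, B}" by blast
  then show ?thesis using p by (simp add: palette_def)
qed

lemma sep_dominates_asym: "sep_dominates U W \<Longrightarrow> \<not> sep_dominates W U"
proof
  assume d: "sep_dominates U W" "sep_dominates W U"
  then obtain x y where xy: "x \<in> U" "y \<in> W" unfolding sep_dominates_def separated_def by blast
  have "col u w = col x y" if "u \<in> U" "w \<in> W" for u w
  proof -
    have "col u w = col u y" using d(1) that xy unfolding sep_dominates_def by blast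
    also have "\<dots> = col x y"
      using d(2) that xy col_commute[of u y] col_commute[of x y] unfolding sep_dominates_def by metis
    finally show ?thesis .
  qed
  then show False using d(1) unfolding sep_dominates_def monochromatic_def by blast
qed

section \<open>The structure of a single level\<close>

text \<open>\<open>forest_order\<close> stands for the rooted trees, and the color count of
  undirected edges is built into \<open>medges\<close>.\<close>

definition well_structured :: "nat set mixed_graph \<Rightarrow> bool" where
  "well_structured M \<longleftrightarrow> complete_mixed M \<and> forest_order (marcs M) \<and>
     (\<forall>U W. (U, W) \<in> marcs M \<longrightarrow> card (colors_between H U W) = 2) \<and>
     (\<forall>U V W. (U, V) \<in> marcs M \<and> (V, W) \<in> marcs M \<longrightarrow> signature H U V = signature H U W)"

text \<open>The invariant from level 1 on. The singletons of level 0 may be joined by two-colored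
  edges and then are not separated.\<close>

definition block_partition :: "nat set set \<Rightarrow> bool" where
  "block_partition P \<longleftrightarrow> \<Union>P = S \<and> (\<forall>U\<in>P. block U \<and> U \<noteq> {}) \<and>
     (\<forall>U\<in>P. \<forall>W\<in>P. U \<noteq> W \<longrightarrow> separated U W)"

abbreviation singletons :: "nat set set" where
  "singletons \<equiv> {{v} |v. v \<in> S}"

lemma arc_singletons_iff:
  "({u}, {v}) \<in> marcs (mixed_on H singletons) \<longleftrightarrow>
     u \<in> S \<and> v \<in> S \<and> u < v \<and> card (rho u v) = 2"
proof -
  have "card (rho u v) > 1 \<longleftrightarrow> card (rho u v) = 2" if "u \<in> S" "v \<in> S" "u \<noteq> v"
    using card_rho_le_2[of u v] that S_subset by (auto simp: subset_iff)
  then show ?thesis by (auto simp: dominates_def colors_between_singletons)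
qed

lemma arc_singletonsE:
  assumes "(U, V) \<in> marcs (mixed_on H singletons)"
  obtains u v where "U = {u}" "V = {v}" "u \<in> S" "v \<in> S" "u < v" "card (rho u v) = 2"
    "u \<in> vertices G" "v \<in> vertices G" "u \<noteq> v"
proof -
  obtain u v where uv: "U = {u}" "V = {v}" using assms by auto
  then have "u \<in> S" "v \<in> S" "u < v" "card (rho u v) = 2" using assms arc_singletons_iff by auto
  then show thesis using that[OF uv] S_subset by auto
qed

text \<open>Arcs are the two-colored edges directed towards the larger vertex. By
  \<open>bicoloured_triangle\<close> two such edges at a vertex complete to a triangle with the same
  two colors throughout.\<close>

lemma well_structured_singletons: "well_structured (mixed_on H singletons)"
proof -
  let ?M = "mixed_on H singletons"
  note [simp del] = mixed_on_simps(3)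
  have complete: "complete_mixed ?M"
    unfolding complete_mixed_def
  proof (intro ballI impI)
    fix X Y assume "X \<in> mverts ?M" "Y \<in> mverts ?M" "X \<noteq> Y"
    then obtain x y where xy: "X = {x}" "Y = {y}" "x \<in> S" "y \<in> S" "x \<noteq> y" by auto
    have "card (rho x y) \<noteq> 0" "card (rho x y) \<le> 2"
      using rho_nonempty[of x y] rho_finite[of x y] card_rho_le_2[of x y] xy S_subset
      by (auto simp: subset_iff)
    then have "card (rho x y) = 1 \<or> card (rho x y) = 2" by linarith
    moreover have "{X, Y} \<in> medges ?M \<longleftrightarrow> card (rho x y) = 1"
      unfolding medges_iff using xy by (auto simp: colors_between_singletons)
    ultimately show "({X, Y} \<in> medges ?M \<and> (X, Y) \<notin> marcs ?M \<and> (Y, X) \<notin> marcs ?M) \<or>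
      ({X, Y} \<notin> medges ?M \<and> (X, Y) \<in> marcs ?M \<and> (Y, X) \<notin> marcs ?M) \<or>
      ({X, Y} \<notin> medges ?M \<and> (X, Y) \<notin> marcs ?M \<and> (Y, X) \<in> marcs ?M)"
      using arc_singletons_iff[of x y] arc_singletons_iff[of y x] xy rho_commute[of x y] by auto
  qed
  have tri: "rho u v = rho u w \<and> (U, W) \<in> marcs ?M"
    if "(U, V) \<in> marcs ?M" "(V, W) \<in> marcs ?M" "U = {u}" "V = {v}" "W = {w}" for U V W u v w
    using that bicoloured_triangle[of u v w] S_subset
    by (auto elim!: arc_singletonsE simp: arc_singletons_iff subset_iff)
  have "forest_order (marcs ?M)"
    unfolding forest_order_def
  proof (intro conjI allI impI)
    show "irrefl (marcs ?M)" by (auto simp: irrefl_def elim!: arc_singletonsE)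
    show "trans (marcs ?M)"
    proof (rule transI)
      fix U V W assume UVW: "(U, V) \<in> marcs ?M" "(V, W) \<in> marcs ?M"
      obtain u v where "U = {u}" "V = {v}" using UVW(1) by (rule arc_singletonsE)
      moreover obtain w where "W = {w}" using UVW(2) by (rule arc_singletonsE)
      ultimately show "(U, W) \<in> marcs ?M" using tri[OF UVW] by blast
    qed
    fix X Y Z assume "(X, Z) \<in> marcs ?M \<and> (Y, Z) \<in> marcs ?M \<and> X \<noteq> Y"
    then obtain x y z where xyz: "X = {x}" "Y = {y}" "Z = {z}" "x \<in> S" "y \<in> S" "z \<in> S" "x \<noteq> y"
      "x < z" "y < z" "card (rho x z) = 2" "card (rho y z) = 2"
      by (auto elim!: arc_singletonsE)
    then have "card (rho x y) = 2"
      using bicoloured_triangle(2)[of x z y] S_subset rho_commute[of y z] by (auto simp: subset_iff)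
    then show "(X, Y) \<in> marcs ?M \<or> (Y, X) \<in> marcs ?M"
      using xyz rho_commute[of x y] by (auto simp: arc_singletons_iff)
  qed
  moreover have "card (colors_between H U W) = 2" if "(U, W) \<in> marcs ?M" for U W
    using that by (auto elim!: arc_singletonsE simp: colors_between_singletons)
  moreover have "signature H U V = signature H U W"
    if "(U, V) \<in> marcs ?M" "(V, W) \<in> marcs ?M" for U V W
  proof -
    from that(1) obtain u v where uv: "U = {u}" "V = {v}" "u < v" by (rule arc_singletonsE)
    from that(2) obtain v' w where "V = {v'}" "W = {w}" "v' < w" by (rule arc_singletonsE)
    with uv have uvw: "U = {u}" "V = {v}" "W = {w}" "u < v" "v < w" by auto
    then show ?thesis
      using tri[OF that uvw(1-3)] colors_between_singletons[of u v] colors_between_singletons[of u w]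
      by (simp add: signature_def restrict_def fun_eq_iff)
  qed
  ultimately show ?thesis using complete unfolding well_structured_def by blast
qed

lemma well_structured_block_partition:
  assumes P: "block_partition P"
  shows "well_structured (mixed_on H P)"
proof -
  let ?M = "mixed_on H P"
  have sep: "separated U W" if "U \<in> P" "W \<in> P" "U \<noteq> W" for U W
    using P that by (simp add: block_partition_def)
  have blk: "block U" "U \<noteq> {}" if "U \<in> P" for U using P that by (simp_all add: block_partition_def)
  have arc: "(U, W) \<in> marcs ?M \<longleftrightarrow> U \<in> P \<and> W \<in> P \<and> sep_dominates U W" for U W
  proof (cases "U \<in> P \<and> W \<in> P \<and> U \<noteq> W")
    case True
    then show ?thesis using dominates_iff_dom[OF sep] by simp
  next
    case False
    have "\<not> dominates H U U" "\<not> sep_dominates U U" by (auto simp: dominates_def sep_dominates_def separated_def)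
    then show ?thesis using False by auto
  qed
  have irr: "\<not> sep_dominates U U" for U by (auto simp: sep_dominates_def separated_def)
  have complete: "complete_mixed ?M"
    unfolding complete_mixed_def
  proof (intro ballI impI)
    fix X Y assume "X \<in> mverts ?M" "Y \<in> mverts ?M" "X \<noteq> Y"
    then have XY: "X \<in> P" "Y \<in> P" "X \<noteq> Y" by simp_all
    have "monochromatic X Y \<or> sep_dominates X Y \<or> sep_dominates Y X"
      using separated_complete[OF sep[OF XY]] blk XY by blast
    moreover have "{X, Y} \<in> medges ?M \<longleftrightarrow> monochromatic X Y"
      unfolding medges_iff using XY card_colors_between_eq_1[OF sep[OF XY]] by simp
    moreover have "\<not> (sep_dominates X Y \<and> sep_dominates Y X)" using sep_dominates_asym by blast
    moreover have "monochromatic X Y \<Longrightarrow> \<not> sep_dominates X Y \<and> \<not> sep_dominates Y X"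
      using monochromatic_commute by (auto simp: sep_dominates_def)
    ultimately show "({X, Y} \<in> medges ?M \<and> (X, Y) \<notin> marcs ?M \<and> (Y, X) \<notin> marcs ?M) \<or>
      ({X, Y} \<notin> medges ?M \<and> (X, Y) \<in> marcs ?M \<and> (Y, X) \<notin> marcs ?M) \<or>
      ({X, Y} \<notin> medges ?M \<and> (X, Y) \<notin> marcs ?M \<and> (Y, X) \<in> marcs ?M)"
      unfolding arc using XY by blast
  qed
  have trans: "sep_dominates U W \<and> (\<forall>u\<in>U. \<forall>v\<in>V. \<forall>w\<in>W. col u w = col u v)"
    if UVW: "U \<in> P" "V \<in> P" "W \<in> P" "sep_dominates U V" "sep_dominates V W" for U V W
  proof -
    \<comment> \<open>Otherwise \<open>U\<close> and \<open>V\<close> would dominate each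
      other.\<close>
    have "U \<noteq> W" using UVW sep_dominates_asym by blast
    then have s: "separated U W" using sep UVW by blast
    obtain A B E F where p: "palette A B U" "palette E F V"
      using sep_dominates_imp_palette[OF UVW(4) blk(1)[OF UVW(1)]] sep_dominates_imp_palette[OF UVW(5) blk(1)[OF UVW(2)]]
      by metis
    have eq: "\<forall>u\<in>U. \<forall>v\<in>V. \<forall>w\<in>W. col u w = col u v"
      using sep_dominates_trans[OF UVW(4,5) s p] by blast
    obtain v w where vw: "v \<in> V" "w \<in> W" using blk(2)[OF UVW(2)] blk(2)[OF UVW(3)] by blast
    have "\<not> monochromatic U W"
    proof
      assume "monochromatic U W"
      then obtain c where c: "\<forall>u\<in>U. \<forall>w\<in>W. col u w = c" unfolding monochromatic_def by blast
      have "col u v = c" if "u \<in> U" "v \<in> V" for u v using c eq vw(2) that by metis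
      then show False using UVW(4) unfolding sep_dominates_def monochromatic_def by blast
    qed
    moreover have "col u w = col u w'" if "u \<in> U" "w \<in> W" "w' \<in> W" for u w w'
      using eq vw(1) that by metis
    ultimately show ?thesis using s eq unfolding sep_dominates_def by blast
  qed
  have "forest_order (marcs ?M)"
    unfolding forest_order_def
  proof (intro conjI allI impI)
    show "irrefl (marcs ?M)" by (rule irreflI) (use arc irr in blast)
    show "trans (marcs ?M)"
    proof (rule transI)
      fix U V W assume "(U, V) \<in> marcs ?M" "(V, W) \<in> marcs ?M"
      then show "(U, W) \<in> marcs ?M" using trans[of U V W] unfolding arc by blast
    qed
    fix X Y Z assume "(X, Z) \<in> marcs ?M \<and> (Y, Z) \<in> marcs ?M \<and> X \<noteq> Y"
    then have XYZ: "X \<in> P" "Y \<in> P" "sep_dominates X Z" "sep_dominates Y Z" "X \<noteq> Y" by (auto simp only: arc)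
    obtain A B E F where p: "palette A B X" "palette E F Y"
      using sep_dominates_imp_palette[OF XYZ(3) blk(1)[OF XYZ(1)]] sep_dominates_imp_palette[OF XYZ(4) blk(1)[OF XYZ(2)]]
      by metis
    have s: "separated X Y" using sep XYZ by blast
    show "(X, Y) \<in> marcs ?M \<or> (Y, X) \<in> marcs ?M"
      unfolding arc using XYZ(1,2) sep_dominates_forest[OF XYZ(3,4) s p]
        separated_complete[OF s blk(1)[OF XYZ(1)] blk(1)[OF XYZ(2)]] by blast
  qed
  moreover have "card (colors_between H U W) = 2" if "(U, W) \<in> marcs ?M" for U W
    using that card_colors_between_dom blk unfolding arc by blast
  moreover have "signature H U V = signature H U W"
    if "(U, V) \<in> marcs ?M" "(V, W) \<in> marcs ?M" for U V W
  proof -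
    have UVW: "U \<in> P" "V \<in> P" "W \<in> P" "sep_dominates U V" "sep_dominates V W" using that unfolding arc by auto
    have s: "separated U V" "separated U W" using UVW(4) trans[OF UVW] unfolding sep_dominates_def by blast+
    have eq: "\<forall>u\<in>U. \<forall>v\<in>V. \<forall>w\<in>W. col u w = col u v" using trans[OF UVW] by blast
    obtain v w where vw: "v \<in> V" "w \<in> W" using blk(2)[OF UVW(2)] blk(2)[OF UVW(3)] by blast
    have "col u ` V = col u ` W" if u: "u \<in> U" for u
    proof -
      have "col u v' = col u w" if "v' \<in> V" for v' using eq u vw(2) that by metis
      then have "col u ` V = (\<lambda>_. col u w) ` V" by (intro image_cong) simp_all
      moreover have "col u w' = col u w" if "w' \<in> W" for w' using eq u vw that by metis
      then have "col u ` W = (\<lambda>_. col u w) ` W" by (intro image_cong) simp_all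
      ultimately show ?thesis using vw by (simp add: image_constant_conv split: if_splits)
    qed
    then show ?thesis
      unfolding signature_def
      using colors_between_separated(2)[OF s(1)] colors_between_separated(2)[OF s(2)]
      by (intro restrict_ext) simp
  qed
  ultimately show ?thesis using complete unfolding well_structured_def by blast
qed

section \<open>Passage to the next level\<close>

text \<open>Members of different weak components are joined by no arc, hence by an undirected edge,
  and \<open>single\<close> makes all edges between them simple. The hypotheses \<open>comp\<close>
  and \<open>single\<close> hold for different reasons at level 0 and later.\<close>

lemma block_partition_step:
  assumes union: "\<Union>P = S" and disj: "\<And>U W. U \<in> P \<Longrightarrow> W \<in> P \<Longrightarrow> U \<noteq> W \<Longrightarrow> U \<inter> W = {}"
    and ne: "{} \<notin> P"
    and ws: "well_structured (mixed_on H P)"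
    and comp: "\<And>C. C \<in> weak_components (mixed_on H P) \<Longrightarrow> block (\<Union>C)"
    and single: "\<And>U W u w. U \<in> P \<Longrightarrow> W \<in> P \<Longrightarrow> U \<noteq> W \<Longrightarrow> card (colors_between H U W) = 1 \<Longrightarrow>
      u \<in> U \<Longrightarrow> w \<in> W \<Longrightarrow> card (rho u w) = 1"
  shows "block_partition (Union ` weak_components (mixed_on H P))"
proof -
  let ?M = "mixed_on H P"
  have CP: "C \<subseteq> P" if "C \<in> weak_components ?M" for C
    using Union_weak_components[of ?M] that by auto
  have nonempty: "\<Union>C \<noteq> {}" if C: "C \<in> weak_components ?M" for C
  proof -
    obtain U where "U \<in> C" using weak_component_nonempty[OF C] by blast
    then have "U \<noteq> {}" using CP[OF C] ne by blast
    then show ?thesis using \<open>U \<in> C\<close> by blast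
  qed
  have "separated (\<Union>C) (\<Union>D)" if CD: "C \<in> weak_components ?M" "D \<in> weak_components ?M" "C \<noteq> D" for C D
  proof -
    have CD': "C \<inter> D = {}" using weak_components_disjoint[OF CD] .
    have cross: "U \<inter> W = {} \<and> (\<forall>u\<in>U. \<forall>w\<in>W. card (rho u w) = 1)" if UW: "U \<in> C" "W \<in> D" for U W
    proof -
      have PUW: "U \<in> P" "W \<in> P" "U \<noteq> W" using CP[OF CD(1)] CP[OF CD(2)] CD' UW by (blast, blast, blast)
      have "W \<notin> C" using CD' UW(2) by blast
      then have "(U, W) \<notin> marcs ?M" "(W, U) \<notin> marcs ?M"
        using weak_component_closed[OF CD(1) UW(1), of W] PUW(2) unfolding mixed_on_simps(1) by blast+
      moreover have "complete_mixed ?M" using ws by (simp add: well_structured_def)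
      ultimately have "{U, W} \<in> medges ?M"
        using PUW unfolding complete_mixed_def mixed_on_simps(1) by blast
      then show ?thesis using single[OF PUW] disj[OF PUW] unfolding medges_iff by blast
    qed
    have "\<Union>C \<subseteq> S" "\<Union>D \<subseteq> S" using CP[OF CD(1)] CP[OF CD(2)] union by auto
    then show ?thesis
      unfolding separated_def using cross nonempty[OF CD(1)] nonempty[OF CD(2)] by blast
  qed
  moreover have "\<Union> (Union ` weak_components ?M) = S"
    using Union_weak_components[of ?M] union by auto
  ultimately show ?thesis
    unfolding block_partition_def using comp nonempty by blast
qed

lemma finite_partition: "\<Union>P = S \<Longrightarrow> finite P"
  using finite_S by (intro finite_UnionD) simp

lemma component_root:
  assumes "\<Union>P = S" "well_structured (mixed_on H P)" "C \<in> weak_components (mixed_on H P)"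
  obtains R where "R \<in> C" "\<And>V. V \<in> C \<Longrightarrow> V \<noteq> R \<Longrightarrow> (R, V) \<in> marcs (mixed_on H P)"
proof (rule weak_component_root)
  show "finite (mverts (mixed_on H P))" using finite_partition[OF assms(1)] by simp
  show "forest_order (marcs (mixed_on H P))" using assms(2) by (simp add: well_structured_def)
qed (use assms that in auto)

lemma block_partition_singletons:
  "block_partition (Union ` weak_components (mixed_on H singletons))"
proof (rule block_partition_step)
  let ?M = "mixed_on H singletons"
  show union: "\<Union>singletons = S" by auto
  show ws: "well_structured ?M" by (rule well_structured_singletons)
  show "block (\<Union>C)" if C: "C \<in> weak_components ?M" for C
  proof -
    obtain R where R: "R \<in> C" "\<And>V. V \<in> C \<Longrightarrow> V \<noteq> R \<Longrightarrow> (R, V) \<in> marcs ?M"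
      using component_root[OF union ws C] by blast
    have CP: "C \<subseteq> singletons" using Union_weak_components[of ?M] C by auto
    then obtain r where r: "R = {r}" "r \<in> S" using R(1) by auto
    define D where "D = \<Union>C - {r}"
    have rD: "d \<in> S \<and> card (rho r d) = 2" if "d \<in> D" for d
    proof -
      have "{d} \<in> C" "d \<noteq> r" using that CP unfolding D_def by auto
      then show ?thesis using R(2)[of "{d}"] r arc_singletons_iff by auto
    qed
    have UC: "\<Union>C = insert r D" using R(1) r by (auto simp: D_def)
    show ?thesis
    proof (cases "D = {}")
      case True
      then show ?thesis using UC by (simp add: block_def)
    next
      case False
      then obtain d where d: "d \<in> D" by blast
      then obtain A B where AB: "rho r d = {A, B}" "A \<noteq> B" using rD[OF d] by (auto simp: card_2_iff)
      \<comment> \<open>All two-colored edges at the root carry the same pair, so the choice of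
        \<open>d\<close> is immaterial.\<close>
      have "rho r v = {A, B}" if "v \<in> D" for v
      proof (cases "v = d")
        case False
        then show ?thesis
          using bicoloured_triangle(1)[of d r v] rD[OF d] rD[OF that] d that r S_subset AB
            rho_commute[of r d] by (auto simp: D_def)
      qed (use AB in simp)
      moreover have "insert r D \<subseteq> S" "r \<notin> D" using r rD by (auto simp: D_def)
      ultimately have "palette A B (insert r D)"
        using palette_bicoloured_clique[of r D A B] False AB by blast
      then show ?thesis unfolding UC block_def by blast
    qed
  qed
  show "card (rho u w) = 1"
    if "U \<in> singletons" "W \<in> singletons" "U \<noteq> W" "card (colors_between H U W) = 1" "u \<in> U" "w \<in> W"
    for U W u w
    using that colors_between_singletons[of u w] by auto
qed auto

text \<open>The root \<open>R\<close> of a component dominates the other members, and a vertex of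
  \<open>S\<close> outside the component lies in a block joined to \<open>R\<close>
  monochromatically. These are the hypotheses of \<open>palette_Union\<close>.\<close>

lemma block_partition_components:
  assumes P: "block_partition P"
  shows "block_partition (Union ` weak_components (mixed_on H P))"
proof (rule block_partition_step)
  let ?M = "mixed_on H P"
  have sep: "separated U W" if "U \<in> P" "W \<in> P" "U \<noteq> W" for U W
    using P that by (simp add: block_partition_def)
  have blk: "block U" "U \<noteq> {}" if "U \<in> P" for U using P that by (simp_all add: block_partition_def)
  show union: "\<Union>P = S" using P by (simp add: block_partition_def)
  show ws: "well_structured ?M" using well_structured_block_partition[OF P] .
  show "{} \<notin> P" using blk by blast
  show "U \<inter> W = {}" if "U \<in> P" "W \<in> P" "U \<noteq> W" for U W
    using sep[OF that] by (simp add: separated_def)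
  show "card (rho u w) = 1" if "U \<in> P" "W \<in> P" "U \<noteq> W" "u \<in> U" "w \<in> W" for U W u w
    using sep[OF that(1-3)] that(4,5) by (simp add: separated_def)
  show "block (\<Union>C)" if C: "C \<in> weak_components ?M" for C
  proof -
    obtain R where R: "R \<in> C" "\<And>V. V \<in> C \<Longrightarrow> V \<noteq> R \<Longrightarrow> (R, V) \<in> marcs ?M"
      using component_root[OF union ws C] by blast
    have CP: "C \<subseteq> P" using Union_weak_components[of ?M] C by auto
    have sep_dominates: "sep_dominates R V" if "V \<in> C - {R}" for V
      using R that CP dominates_iff_dom[OF sep] by auto
    show ?thesis
    proof (cases "C = {R}")
      case True
      then show ?thesis using blk CP by auto
    next
      case False
      then obtain V where "V \<in> C - {R}" using R(1) by blast
      then obtain A B where p: "palette A B R" using sep_dominates_imp_palette sep_dominates blk R(1) CP by blast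
      have UC: "\<Union>C = R \<union> \<Union>(C - {R})" using R(1) by auto
      have "palette A B (R \<union> \<Union>(C - {R}))"
      proof (rule palette_Union[OF p sep_dominates])
        fix y r s assume y: "y \<in> S - (R \<union> \<Union>(C - {R}))" and rs: "r \<in> R" "s \<in> R"
        then obtain Y where Y: "Y \<in> P" "y \<in> Y" "Y \<notin> C" using union UC by blast
        have RY: "R \<in> P" "R \<noteq> Y" using R(1) CP Y by auto
        have "(R, Y) \<notin> marcs ?M" "(Y, R) \<notin> marcs ?M"
          using weak_component_closed[OF C R(1), of Y] Y by auto
        then have "\<not> sep_dominates R Y" "\<not> sep_dominates Y R"
          using RY Y dominates_iff_dom[OF sep, of R Y] dominates_iff_dom[OF sep, of Y R] by auto
        then have "monochromatic R Y"
          using separated_complete[OF sep[OF RY(1) Y(1) RY(2)]] blk RY Y by blast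
        then have "col r y = col s y" using rs Y by (auto simp: monochromatic_def)
        then show "rho y r = rho y s"
          using rho_eq_col(2)[OF sep[OF RY(1) Y(1) RY(2)] _ Y(2)] rs by simp
      qed
      then show ?thesis unfolding UC block_def by blast
    qed
  qed
qed

lemma mixed_eq: "mixed H n = mixed_on H (mverts (mixed H n))"
  by (cases n) simp_all

lemma block_partition_mixed_Suc: "block_partition (mverts (mixed H (Suc n)))"
proof (induction n)
  case 0
  then show ?case using block_partition_singletons by simp
next
  case (Suc n)
  then show ?case
    using block_partition_components[OF Suc] mixed_eq[of "Suc n"] by simp
qed

lemma mixed_well_structured: "well_structured (mixed H n)" and Union_mixed: "\<Union>(mverts (mixed H n)) = S"
proof -
  have "well_structured (mixed H n) \<and> \<Union>(mverts (mixed H n)) = S"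
  proof (cases n)
    case 0
    have "\<Union>singletons = S" by auto
    then show ?thesis
      unfolding 0 mixed.simps vertices_H mixed_on_simps(1) using well_structured_singletons by blast
  next
    case (Suc m)
    have "block_partition (mverts (mixed H n))" using block_partition_mixed_Suc Suc by simp
    then show ?thesis
      using well_structured_block_partition[of "mverts (mixed H n)"] mixed_eq[of n]
      by (simp add: block_partition_def)
  qed
  then show "well_structured (mixed H n)" "\<Union>(mverts (mixed H n)) = S" by auto
qed

end

theorem theorem2p3:
  fixes G H :: "'c multigraph" and S :: "nat set" and n :: nat
  assumes "maximal_gallai G" and "reduced G"
    and "S \<subseteq> vertices G" and "H = induced G S"
  shows "complete_mixed (mixed H n) \<and>
    (\<forall>U W. {U, W} \<in> medges (mixed H n) \<longrightarrow> card (colors_between H U W) = 1) \<and>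
    (\<forall>U W. (U, W) \<in> marcs (mixed H n) \<longrightarrow> card (colors_between H U W) = 2) \<and>
    (\<forall>C \<in> weak_components (mixed H n). rooted_tree C (marcs (mixed H n) \<inter> C \<times> C)) \<and>
    (\<forall>U V W. (U, V) \<in> marcs (mixed H n) \<and> (V, W) \<in> marcs (mixed H n) \<longrightarrow>
       signature H U V = signature H U W)"
proof -
  interpret reduced_maximal_gallai G S using assms(1-3) by (rule reduced_maximal_gallai.intro)
  let ?M = "mixed (induced G S) n"
  define P where "P = mverts ?M"
  have M: "?M = mixed_on (induced G S) P" unfolding P_def by (rule mixed_eq)
  have ws: "well_structured ?M" by (rule mixed_well_structured)
  have "rooted_tree C (marcs ?M \<inter> C \<times> C)" if "C \<in> weak_components ?M" for C
  proof (rule rooted_tree_weak_component[OF _ _ _ that])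
    show "finite (mverts ?M)" using finite_partition[OF Union_mixed] .
    show "marcs ?M \<subseteq> mverts ?M \<times> mverts ?M" unfolding M by auto
    show "forest_order (marcs ?M)" using ws by (simp add: well_structured_def)
  qed
  moreover have "card (colors_between (induced G S) U W) = 1" if "{U, W} \<in> medges ?M" for U W
    using that unfolding M medges_iff by blast
  ultimately show ?thesis
    using ws unfolding assms(4) well_structured_def by blast
qed

end
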